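(* Let $P\in K[[h]]$ be a formal series with constant term $1$. The following assertions are equivalent: 1. $\mathcal{A}_{N,P}$ is a Hopf subalgebra of $\mathcal{H}_{NCK}$. 2. $\mathcal{A}_P$ is a Hopf subalgebra of $\mathcal{H}_{CK}$. 3. There exists $(\alpha,\beta)\in K^2$ such that $P$ satisfies the differential system $(1-\alpha\beta h)P'(h)=\alpha P(h)$, $P(0)=1$. 4. There exists $(\alpha,\beta)\in K^2$ such that: (a) $P(h)=1$ if $\alpha=0$; (b) $P(h)=e^{\alpha h}$ if $\beta=0$; (c) $P(h)=(1-\alpha\beta h)^{-1/\beta}$ if $\alpha\beta\neq 0$.
   Context: $K$ is a field of characteristic zero. For $\lambda\in K$, $(1-h)^{-\lambda}=\sum_{k\ge 0}\frac{\lambda(\lambda+1)\cdots(\lambda+k-1)}{k!}h^k\in K[[h]]$. A rooted tree is a finite connected graph without loops (cycles) with a distinguished vertex, the root; trees are taken up to isomorphism. A planar rooted tree is a rooted tree with an embedding in the plane. The weight of a tree is its number of vertices, and $\bullet$ is the tree of weight $1$. $\mathcal{H}_{CK}$ (Connes-Kreimer Hopf algebra) is, as an algebra, the free commutative unital $K$-algebra generated by rooted trees; its basis consists of rooted forests (monomials in trees). $\mathcal{H}_{NCK}$ is, as an algebra, the free associative unital $K$-algebra generated by planar rooted trees; its basis consists of planar forests (words in planar trees). Both are graded by weight (the weight of a forest is the sum of the weights of its trees). In both cases $B^+$ is the linear operator sending a forest to the tree obtained by grafting the roots of its trees (in order, in the planar case) on a common new root; $B^+(1)=\bullet$. The coproduct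 $\Delta$ is the unique algebra morphism such that $\Delta(B^+(x))=B^+(x)\otimes 1+(\mathrm{Id}\otimes B^+)\circ\Delta(x)$ for all $x$ (equivalently it is given by admissible cuts); with it both are graded connected Hopf algebras. The completion of a graded algebra $\mathcal{A}=\bigoplus_n\mathcal{A}_n$ is $\overline{\mathcal{A}}=\prod_{n}\mathcal{A}_n$; $B^+$ and the product extend continuously to completions. For $P=\sum_{k\ge0}p_kh^k$ with $p_0=1$, $X_P=\sum_{n\geq1}a_n\in\overline{\mathcal{H}_{CK}}$ ($a_n$ homogeneous of degree $n$) is the unique solution of $X_P=B^+(P(X_P))$, where $P(x)=\sum_k p_kx^k$; explicitly $a_1=\bullet$ and $a_{n+1}=\sum_{k=1}^n\sum_{\alpha_1+\cdots+\alpha_k=n}p_kB^+(a_{\alpha_1}\cdots a_{\alpha_k})$ with all $\alpha_i\ge1$. Similarly $\mathbf{X}_P=\sum_{n\ge1}\mathbf{a}_n\in\overline{\mathcal{H}_{NCK}}$ is the unique solution of $\mathbf{X}_P=B^+(P(\mathbf{X}_P))$. $\mathcal{A}_P$ is the unital subalgebra of $\mathcal{H}_{CK}$ generated by the $a_n$ ($n\ge1$), and $\mathcal{A}_{N,P}$ is the unital subalgebra of $\mathcal{H}_{NCK}$ generated by the $\mathbf{a}_n$ ($n\geq 1$). *)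

theory Defs
  imports
    "HOL-Library.Poly_Mapping"
    "HOL-Library.Product_Plus"
    "HOL-Library.Multiset"
    "HOL-Computational_Algebra.Formal_Power_Series"
begin

section \<open>Monoid algebras and their tensor squares\<close>

text \<open>
  The type \<open>'f \<Rightarrow>\<^sub>0 'k\<close> of finitely supported functions is the free \<open>'k\<close>-module with basis \<open>'f\<close>.
  If \<open>'f\<close> is an (additively written) monoid, the ring multiplication on this type is convolution,
  i.e. it is the monoid algebra of \<open>'f\<close>, with unit \<open>1 = single 0 1\<close>. The tensor product of the free
  modules on \<open>'f\<close> and \<open>'g\<close> is the free module on \<open>'f \<times> 'g\<close>, and for monoids the multiplication of
  \<open>('f \<times> 'g) \<Rightarrow>\<^sub>0 'k\<close> is the usual one, with \<open>(x \<otimes> y) (x' \<otimes> y') = x x' \<otimes> y y'\<close>.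
\<close>

definition scale :: "'k \<Rightarrow> ('f \<Rightarrow>\<^sub>0 'k) \<Rightarrow> ('f \<Rightarrow>\<^sub>0 'k::field_char_0)" where
  "scale c x = Poly_Mapping.map ((*) c) x"

lemma lookup_scale [simp]: "Poly_Mapping.lookup (scale c x) f = c * Poly_Mapping.lookup x f"
  by (simp add: scale_def Poly_Mapping.map.rep_eq when_def)

global_interpretation free: vector_space "scale :: 'k \<Rightarrow> ('f \<Rightarrow>\<^sub>0 'k) \<Rightarrow> ('f \<Rightarrow>\<^sub>0 'k::field_char_0)"
  by unfold_locales (auto intro!: poly_mapping_eqI simp: lookup_add algebra_simps)

text \<open>The linear map with prescribed values on the basis.\<close>

definition lin_ext :: "('f \<Rightarrow> ('g \<Rightarrow>\<^sub>0 'k)) \<Rightarrow> ('f \<Rightarrow>\<^sub>0 'k) \<Rightarrow> ('g \<Rightarrow>\<^sub>0 'k::field_char_0)" where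
  "lin_ext \<phi> x = (\<Sum>f\<in>Poly_Mapping.keys x. scale (Poly_Mapping.lookup x f) (\<phi> f))"

definition tensor :: "('f \<Rightarrow>\<^sub>0 'k) \<Rightarrow> ('g \<Rightarrow>\<^sub>0 'k) \<Rightarrow> (('f \<times> 'g) \<Rightarrow>\<^sub>0 'k::field_char_0)" where
  "tensor x y = lin_ext (\<lambda>f. lin_ext (\<lambda>g. Poly_Mapping.single (f, g) 1) y) x"

text \<open>The map \<open>u \<otimes> v\<close>, for linear \<open>u\<close> and \<open>v\<close>.\<close>

definition tensor_map ::
  "(('f \<Rightarrow>\<^sub>0 'k) \<Rightarrow> ('f' \<Rightarrow>\<^sub>0 'k)) \<Rightarrow> (('g \<Rightarrow>\<^sub>0 'k) \<Rightarrow> ('g' \<Rightarrow>\<^sub>0 'k)) \<Rightarrow>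
   (('f \<times> 'g) \<Rightarrow>\<^sub>0 'k) \<Rightarrow> (('f' \<times> 'g') \<Rightarrow>\<^sub>0 'k::field_char_0)" where
  "tensor_map u v = lin_ext (\<lambda>(f, g). tensor (u (Poly_Mapping.single f 1)) (v (Poly_Mapping.single g 1)))"

text \<open>The multiplication \<open>A \<otimes> A \<rightarrow> A\<close>.\<close>

definition mult_map :: "(('f \<times> 'f) \<Rightarrow>\<^sub>0 'k) \<Rightarrow> ('f::monoid_add \<Rightarrow>\<^sub>0 'k::field_char_0)" where
  "mult_map = lin_ext (\<lambda>(f, g). Poly_Mapping.single f 1 * Poly_Mapping.single g 1)"

definition unital_subalgebra :: "('f::monoid_add \<Rightarrow>\<^sub>0 'k::field_char_0) set \<Rightarrow> bool" where
  "unital_subalgebra B \<longleftrightarrow> free.subspace B \<and> 1 \<in> B \<and> (\<forall>x\<in>B. \<forall>y\<in>B. x * y \<in> B)"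


section \<open>Hopf subalgebras\<close>

text \<open>An antipode is a two-sided convolution inverse of the identity; it is unique if the coproduct
  is coassociative with counit \<open>\<epsilon>\<close>.\<close>

definition is_antipode ::
  "(('f::monoid_add \<Rightarrow>\<^sub>0 'k::field_char_0) \<Rightarrow> (('f \<times> 'f) \<Rightarrow>\<^sub>0 'k)) \<Rightarrow> (('f \<Rightarrow>\<^sub>0 'k) \<Rightarrow> 'k) \<Rightarrow>
   (('f \<Rightarrow>\<^sub>0 'k) \<Rightarrow> ('f \<Rightarrow>\<^sub>0 'k)) \<Rightarrow> bool" where
  "is_antipode \<Delta> \<epsilon> S \<longleftrightarrow>
     Vector_Spaces.linear scale scale S \<and>
     (\<forall>x. mult_map (tensor_map S id (\<Delta> x)) = scale (\<epsilon> x) 1) \<and>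
     (\<forall>x. mult_map (tensor_map id S (\<Delta> x)) = scale (\<epsilon> x) 1)"

definition hopf_subalgebra ::
  "(('f::monoid_add \<Rightarrow>\<^sub>0 'k::field_char_0) \<Rightarrow> (('f \<times> 'f) \<Rightarrow>\<^sub>0 'k)) \<Rightarrow> (('f \<Rightarrow>\<^sub>0 'k) \<Rightarrow> 'k) \<Rightarrow>
   ('f \<Rightarrow>\<^sub>0 'k) set \<Rightarrow> bool" where
  "hopf_subalgebra \<Delta> \<epsilon> B \<longleftrightarrow>
     unital_subalgebra B \<and>
     (\<forall>x\<in>B. \<Delta> x \<in> free.span {tensor y z |y z. y \<in> B \<and> z \<in> B}) \<and>
     (\<exists>S. is_antipode \<Delta> \<epsilon> S \<and> S ` B \<subseteq> B)"

text \<open>In both algebras below the counit is the coefficient of the empty forest.\<close>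

definition counit :: "('f::monoid_add \<Rightarrow>\<^sub>0 'k::field_char_0) \<Rightarrow> 'k" where
  "counit x = Poly_Mapping.lookup x 0"


section \<open>Rooted trees and the two Hopf algebras\<close>

text \<open>A rooted tree up to isomorphism is determined by the multiset of the subtrees attached to its
  root, a planar rooted tree by the sequence of these subtrees. A rooted forest (a monomial in
  trees) is a multiset of trees, a planar forest is a word in planar trees.\<close>

datatype rtree = RNode "rtree multiset"

datatype ptree = PNode "ptree list"

text \<open>Lists form the free monoid under concatenation.\<close>

instantiation list :: (type) monoid_add
begin

definition zero_list :: "'a list" where "zero_list = []"

definition plus_list :: "'a list \<Rightarrow> 'a list \<Rightarrow> 'a list" where "plus_list xs ys = xs @ ys"

instance by standard (simp_all add: zero_list_def plus_list_def)

end

text \<open>The free commutative algebra on rooted trees and the free associative algebra on planar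
  rooted trees.\<close>

type_synonym 'k ck = "rtree multiset \<Rightarrow>\<^sub>0 'k"

type_synonym 'k nck = "ptree list \<Rightarrow>\<^sub>0 'k"

definition ck_graft :: "'k ck \<Rightarrow> 'k::field_char_0 ck" where
  "ck_graft = lin_ext (\<lambda>F. Poly_Mapping.single {#RNode F#} 1)"

definition nck_graft :: "'k nck \<Rightarrow> 'k::field_char_0 nck" where
  "nck_graft = lin_ext (\<lambda>F. Poly_Mapping.single [PNode F] 1)"

text \<open>The coproduct is defined by recursion on trees, extended multiplicatively to forests and then
  linearly; the lemmas below give the characterisation through \<open>B\<^sup>+\<close>.\<close>

primrec ck_coproduct_tree :: "rtree \<Rightarrow> ((rtree multiset \<times> rtree multiset) \<Rightarrow>\<^sub>0 'k::field_char_0)" where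
  "ck_coproduct_tree (RNode F) =
     tensor (Poly_Mapping.single {#RNode F#} 1) 1 +
     tensor_map id ck_graft (prod_mset (image_mset ck_coproduct_tree F))"

definition ck_coproduct :: "'k ck \<Rightarrow> ((rtree multiset \<times> rtree multiset) \<Rightarrow>\<^sub>0 'k::field_char_0)" where
  "ck_coproduct = lin_ext (\<lambda>F. prod_mset (image_mset ck_coproduct_tree F))"

primrec nck_coproduct_tree :: "ptree \<Rightarrow> ((ptree list \<times> ptree list) \<Rightarrow>\<^sub>0 'k::field_char_0)" where
  "nck_coproduct_tree (PNode F) =
     tensor (Poly_Mapping.single [PNode F] 1) 1 +
     tensor_map id nck_graft (prod_list (map nck_coproduct_tree F))"

definition nck_coproduct :: "'k nck \<Rightarrow> ((ptree list \<times> ptree list) \<Rightarrow>\<^sub>0 'k::field_char_0)" where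
  "nck_coproduct = lin_ext (\<lambda>F. prod_list (map nck_coproduct_tree F))"

lemma lin_ext_superset:
  assumes "finite A" "Poly_Mapping.keys x \<subseteq> A"
  shows "lin_ext \<phi> x = (\<Sum>f\<in>A. scale (Poly_Mapping.lookup x f) (\<phi> f))"
  unfolding lin_ext_def
  by (rule sum.mono_neutral_left) (use assms in \<open>auto simp: in_keys_iff\<close>)

lemma lin_ext_add: "lin_ext \<phi> (x + y) = lin_ext \<phi> x + lin_ext \<phi> y"
proof -
  let ?A = "Poly_Mapping.keys x \<union> Poly_Mapping.keys y"
  have "lin_ext \<phi> z = (\<Sum>f\<in>?A. scale (Poly_Mapping.lookup z f) (\<phi> f))" if "Poly_Mapping.keys z \<subseteq> ?A" for z
    using that by (intro lin_ext_superset) auto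
  then show ?thesis
    by (simp add: Poly_Mapping.keys_add lookup_add free.scale_left_distrib sum.distrib)
qed

lemma lin_ext_scale: "lin_ext \<phi> (scale c x) = scale c (lin_ext \<phi> x)"
proof -
  have "lin_ext \<phi> (scale c x) = (\<Sum>f\<in>Poly_Mapping.keys x. scale (Poly_Mapping.lookup (scale c x) f) (\<phi> f))"
    by (intro lin_ext_superset) (auto simp: in_keys_iff)
  then show ?thesis
    by (simp add: lin_ext_def free.scale_sum_right)
qed

lemma lin_ext_single [simp]: "lin_ext \<phi> (Poly_Mapping.single f 1) = \<phi> f"
  by (simp add: lin_ext_def)

lemma linear_lin_ext: "Vector_Spaces.linear scale scale (lin_ext \<phi>)"
  by unfold_locales (simp_all add: lin_ext_add lin_ext_scale)

lemma single_eq_scale: "Poly_Mapping.single f c = scale c (Poly_Mapping.single f 1)"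
  by (rule poly_mapping_eqI) (simp add: lookup_single when_def)

lemma basis_induct [case_names basis scale add]:
  assumes basis: "\<And>f. Q (Poly_Mapping.single f 1)"
    and scale: "\<And>c x. Q x \<Longrightarrow> Q (scale c x)"
    and add: "\<And>x y. Q x \<Longrightarrow> Q y \<Longrightarrow> Q (x + y)"
  shows "Q x"
proof -
  have zero: "Q 0" using scale[OF basis, of 0 undefined] by simp
  have "x = (\<Sum>f\<in>Poly_Mapping.keys x. scale (Poly_Mapping.lookup x f) (Poly_Mapping.single f 1))"
    by (rule poly_mapping_eqI)
      (auto simp: lookup_sum lookup_single when_def in_keys_iff if_distrib sum.delta cong: if_cong)
  moreover have "Q (\<Sum>f\<in>A. scale (c f) (Poly_Mapping.single f 1))" for A c
    by (induction A rule: infinite_finite_induct) (auto intro: zero basis scale add)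
  ultimately show ?thesis by metis
qed

lemma scale_mult_left: "scale c x * y = scale c (x * y)"
  by (simp add: scale_def mult_map_scale_conv_mult mult.assoc)

lemma scale_mult_right: "x * scale c y = scale c (x * y)"
proof (induction x rule: basis_induct)
  case (basis f)
  show ?case
  proof (induction y arbitrary: c rule: basis_induct)
    case (basis g)
    show ?case
      by (simp add: mult_single flip: single_eq_scale)
  next
    case (scale d y)
    show ?case
      using scale[of "c * d"] scale[of d] by simp
  qed (simp add: distrib_left free.scale_right_distrib)
qed (simp_all add: distrib_right free.scale_right_distrib scale_mult_left free.scale_left_commute)

lemma lin_ext_mult:
  assumes "\<And>f g. \<phi> (f + g) = \<phi> f * \<phi> g"
  shows "lin_ext \<phi> (x * y) = lin_ext \<phi> x * lin_ext \<phi> y"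
proof (induction x rule: basis_induct)
  case (basis f)
  show ?case
    by (induction y rule: basis_induct)
      (simp_all add: mult_single assms distrib_left lin_ext_add lin_ext_scale scale_mult_right)
qed (simp_all add: distrib_right lin_ext_add lin_ext_scale scale_mult_left)

lemma ck_coproduct_one: "ck_coproduct 1 = 1"
  by (simp add: ck_coproduct_def flip: single_one)

lemma ck_coproduct_mult: "ck_coproduct (x * y) = ck_coproduct x * ck_coproduct y"
  unfolding ck_coproduct_def by (rule lin_ext_mult) simp

lemma tensor_add_left: "tensor (x + y) z = tensor x z + tensor y z"
  by (simp add: tensor_def lin_ext_add)

lemma tensor_scale_left: "tensor (scale c x) z = scale c (tensor x z)"
  by (simp add: tensor_def lin_ext_scale)

lemma ck_coproduct_graft:
  "ck_coproduct (ck_graft x) = tensor (ck_graft x) 1 + tensor_map id ck_graft (ck_coproduct x)"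
proof (induction x rule: basis_induct)
  case (basis F)
  then show ?case by (simp add: ck_coproduct_def ck_graft_def del: id_apply)
qed (simp_all add: ck_coproduct_def ck_graft_def tensor_map_def lin_ext_add lin_ext_scale
       tensor_add_left tensor_scale_left free.scale_right_distrib)

lemma nck_coproduct_one: "nck_coproduct 1 = 1"
  by (simp add: nck_coproduct_def zero_list_def flip: single_one)

lemma nck_coproduct_mult: "nck_coproduct (x * y) = nck_coproduct x * nck_coproduct y"
  unfolding nck_coproduct_def by (rule lin_ext_mult) (simp add: plus_list_def)

lemma nck_coproduct_graft:
  "nck_coproduct (nck_graft x) = tensor (nck_graft x) 1 + tensor_map id nck_graft (nck_coproduct x)"
proof (induction x rule: basis_induct)
  case (basis F)
  then show ?case by (simp add: nck_coproduct_def nck_graft_def del: id_apply)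
qed (simp_all add: nck_coproduct_def nck_graft_def tensor_map_def lin_ext_add lin_ext_scale
       tensor_add_left tensor_scale_left free.scale_right_distrib)


section \<open>The combinatorial Dyson--Schwinger equation\<close>

definition compositions :: "nat \<Rightarrow> nat \<Rightarrow> nat list set" where
  "compositions n k = {\<alpha>. length \<alpha> = k \<and> sum_list \<alpha> = n \<and> (\<forall>i\<in>set \<alpha>. 1 \<le> i)}"

text \<open>The homogeneous components of the solution of \<open>X = B\<^sup>+(P(X))\<close>, where \<open>b\<close> plays the role of
  \<open>B\<^sup>+\<close>. The solution has no component of degree \<open>0\<close>.\<close>

function dse_coeff ::
  "(('f::monoid_add \<Rightarrow>\<^sub>0 'k::field_char_0) \<Rightarrow> ('f \<Rightarrow>\<^sub>0 'k)) \<Rightarrow> 'k fps \<Rightarrow> nat \<Rightarrow> ('f \<Rightarrow>\<^sub>0 'k)" where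
  "dse_coeff b P 0 = 0"
| "dse_coeff b P (Suc 0) = b 1"
| "dse_coeff b P (Suc (Suc m)) =
     (\<Sum>k=1..Suc m. \<Sum>\<alpha>\<in>compositions (Suc m) k.
        scale (fps_nth P k) (b (prod_list (map (dse_coeff b P) \<alpha>))))"
  by pat_completeness auto
termination
proof (relation "measure (\<lambda>(b, P, n). n)")
  fix b :: "('f \<Rightarrow>\<^sub>0 'k) \<Rightarrow> ('f \<Rightarrow>\<^sub>0 'k)" and P :: "'k fps" and m k i :: nat and \<alpha>
  assume "\<alpha> \<in> compositions (Suc m) k" "i \<in> set \<alpha>"
  then have "i \<le> Suc m"
    using member_le_sum_list[of i \<alpha>] by (auto simp: compositions_def)
  then show "((b, P, i), (b, P, Suc (Suc m))) \<in> measure (\<lambda>(b, P, n). n)"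
    by simp
qed simp

text \<open>Writing the element \<open>\<Sum>\<^sub>n a\<^sub>n\<close> of the completion as the power series \<open>\<Sum>\<^sub>n a\<^sub>n h\<^sup>n\<close>, in which \<open>h\<close>
  marks the weight, the equation \<open>X = B\<^sup>+(P(X))\<close> holds degree by degree.\<close>

lemma compositions_Suc:
  "compositions n (Suc k) = (\<Union>i\<in>{1..n}. (#) i ` compositions (n - i) k)"
  by (fastforce simp: compositions_def length_Suc_conv image_iff)

lemma finite_compositions: "finite (compositions n k)"
proof (induction k arbitrary: n)
  case 0
  have "compositions n 0 \<subseteq> {[]}" by (auto simp: compositions_def)
  then show ?case by (rule finite_subset) simp
qed (simp add: compositions_Suc)

lemma nth_power_eq_sum_compositions:
  fixes a :: "nat \<Rightarrow> 'a::ring_1"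
  assumes "a 0 = 0"
  shows "fps_nth (Abs_fps a ^ k) n = (\<Sum>\<alpha>\<in>compositions n k. prod_list (map a \<alpha>))"
proof (induction k arbitrary: n)
  case 0
  have "compositions n 0 = (if n = 0 then {[]} else {})" by (auto simp: compositions_def)
  then show ?case by simp
next
  case (Suc k)
  have "fps_nth (Abs_fps a ^ Suc k) n = (\<Sum>i=0..n. a i * fps_nth (Abs_fps a ^ k) (n - i))"
    by (simp add: fps_mult_nth)
  also have "\<dots> = (\<Sum>i=1..n. a i * fps_nth (Abs_fps a ^ k) (n - i))"
    using assms by (intro sum.mono_neutral_right) (auto simp: not_less_eq_eq Suc_le_eq)
  also have "\<dots> = (\<Sum>i=1..n. \<Sum>\<alpha>\<in>(#) i ` compositions (n - i) k. prod_list (map a \<alpha>))"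
    by (intro sum.cong refl) (simp add: Suc sum.reindex sum_distrib_left)
  also have "\<dots> = (\<Sum>\<alpha>\<in>compositions n (Suc k). prod_list (map a \<alpha>))"
    unfolding compositions_Suc
    by (rule sum.UNION_disjoint [symmetric]) (auto simp: finite_compositions)
  finally show ?case .
qed

lemma dse_coeff_equation:
  fixes P :: "'k::field_char_0 fps" and b :: "('f::monoid_add \<Rightarrow>\<^sub>0 'k) \<Rightarrow> ('f \<Rightarrow>\<^sub>0 'k)"
  assumes b: "Vector_Spaces.linear scale scale b" and P: "fps_nth P 0 = 1"
  defines "X \<equiv> Abs_fps (dse_coeff b P)"
  shows "fps_nth X 0 = 0"
    and "fps_nth X (Suc n) = b (\<Sum>k\<le>n. scale (fps_nth P k) (fps_nth (X ^ k) n))"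
proof -
  interpret b: Vector_Spaces.linear scale scale b by (rule b)
  show "fps_nth X 0 = 0" by (simp add: X_def)
  show "fps_nth X (Suc n) = b (\<Sum>k\<le>n. scale (fps_nth P k) (fps_nth (X ^ k) n))"
  proof (cases n)
    case 0
    then show ?thesis by (simp add: X_def P)
  next
    case (Suc m)
    have "(\<Sum>k\<le>n. scale (fps_nth P k) (fps_nth (X ^ k) n)) =
          (\<Sum>k=1..n. scale (fps_nth P k) (fps_nth (X ^ k) n))"
      using Suc by (intro sum.mono_neutral_right) (auto simp: not_less_eq_eq Suc_le_eq)
    then show ?thesis
      using Suc by (simp add: X_def nth_power_eq_sum_compositions b.sum b.scale free.scale_sum_right del: sum.cl_ivl_Suc)
  qed
qed

definition ck_dse_subalgebra :: "'k fps \<Rightarrow> 'k::field_char_0 ck set" where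
  "ck_dse_subalgebra P = unital_subalgebra hull {dse_coeff ck_graft P n |n. 1 \<le> n}"

definition nck_dse_subalgebra :: "'k fps \<Rightarrow> 'k::field_char_0 nck set" where
  "nck_dse_subalgebra P = unital_subalgebra hull {dse_coeff nck_graft P n |n. 1 \<le> n}"

text \<open>The series \<open>(1 - h)\<^bsup>-l\<^esup>\<close>.\<close>

definition neg_binomial_series :: "'k \<Rightarrow> 'k::field_char_0 fps" where
  "neg_binomial_series l = Abs_fps (\<lambda>k. pochhammer l k / fact k)"

end

theory Submission
  imports Defs
begin

text \<open>
  Both Hopf algebras are monoid algebras on a monoid of forests that is generated by grafting from the
  empty forest, and the coproduct is governed by the same recursion through \<open>B\<^sup>+\<close>. The argument is
  therefore carried out once, in the locale \<open>forest_bialgebra\<close>, where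
  \<open>hopf_subalgebra_dse_iff_ode\<close> shows that the subalgebra generated by the components of the solution
  \<open>X = \<Sum>\<^sub>n a\<^sub>n h\<^sup>n\<close> is a Hopf subalgebra iff \<open>P\<close> satisfies the differential equation. The commutative and the
  planar assertion are equivalent because each of them is equivalent to this equation. Throughout, \<open>h\<close>
  marks the weight, so the completed algebras are represented by power series over the algebras.

  The equation is sufficient. With \<open>\<gamma> = \<alpha> \<beta>\<close> it implies \<open>P(x + y - \<gamma> x y) = P(x) P(y)\<close> for
  commuting \<open>x\<close> and \<open>y\<close> (\<open>fps_eval_ode\<close>). This functional equation allows one to guess and verify the
  solution of the fixed point equation \<open>\<Delta>(X) = X \<otimes> 1 + h (id \<otimes> B\<^sup>+)(P(\<Delta>(X)))\<close>, namely
  \<open>\<Delta>(X) = X \<otimes> 1 + \<Sum>\<^sub>n (1 - \<gamma> X) s\<^sup>n \<otimes> a\<^sub>n h\<^sup>n\<close> with \<open>s = P(X) / (1 - \<gamma> X)\<close> (\<open>coproduct_dse\<close>).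
  The left factors are series in \<open>X\<close>, so the subalgebra is stable under the coproduct. Stability under
  the antipode is then automatic (\<open>hopf_subalgebraI\<close>), as the antipode is a locally finite geometric
  series of convolution powers of the projection on the augmentation ideal.

  The equation is necessary. Contracting the left tensor factor of the coproduct with the coefficient of
  the one-vertex tree gives a derivation \<open>D\<close>, which deletes a leaf in all possible ways. It preserves a
  Hopf subalgebra and sends \<open>a\<^bsub>n+1\<^esub>\<close> to a combination of trees of weight \<open>n\<close>, and the only such elements
  of the subalgebra are the multiples of \<open>a\<^sub>n\<close> (\<open>tree_part_dse_subalgebra\<close>). Hence
  \<open>D(a\<^bsub>n+1\<^esub>) = \<mu>\<^sub>n a\<^sub>n\<close> for \<open>n \<ge> 1\<close>. Comparing the coefficients of corollas, and the trees whose root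
  has a single branch, turns this into two recurrences for \<open>\<mu>\<close> and the coefficients of \<open>P\<close>
  (\<open>dse_recurrences\<close>), which together are the recurrence expressing the differential equation.

  The closed forms solve the same first-order recurrence with the same initial value.
\<close>

section \<open>Linear extension of functions on a basis\<close>

abbreviation basis_vec :: "'f \<Rightarrow> ('f \<Rightarrow>\<^sub>0 'k::field_char_0)" where
  "basis_vec f \<equiv> Poly_Mapping.single f 1"

lemma lin_ext_zero [simp]: "lin_ext \<phi> 0 = 0"
  by (simp add: lin_ext_def)

lemma lin_ext_sum: "lin_ext \<phi> (sum x A) = (\<Sum>i\<in>A. lin_ext \<phi> (x i))"
  by (induction A rule: infinite_finite_induct) (simp_all add: lin_ext_add)

lemma lin_ext_cong:
  "(\<And>f. f \<in> Poly_Mapping.keys x \<Longrightarrow> \<phi> f = \<psi> f) \<Longrightarrow> lin_ext \<phi> x = lin_ext \<psi> x"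
  by (simp add: lin_ext_def)

lemma lin_ext_lin_ext: "lin_ext \<phi> (lin_ext \<psi> x) = lin_ext (\<lambda>f. lin_ext \<phi> (\<psi> f)) x"
  by (induction x rule: basis_induct) (simp_all add: lin_ext_add lin_ext_scale)

lemma lin_ext_basis_vec [simp]: "lin_ext basis_vec x = x"
  by (induction x rule: basis_induct) (simp_all add: lin_ext_add lin_ext_scale)

lemma lin_ext_add_fun: "lin_ext (\<lambda>f. \<phi> f + \<psi> f) x = lin_ext \<phi> x + lin_ext \<psi> x"
  by (simp add: lin_ext_def free.scale_right_distrib sum.distrib)

lemma lin_ext_scale_fun: "lin_ext (\<lambda>f. scale c (\<phi> f)) x = scale c (lin_ext \<phi> x)"
  by (simp add: lin_ext_def free.scale_sum_right mult.commute)

lemma lin_ext_sum_fun: "lin_ext (\<lambda>f. \<Sum>i\<in>A. \<phi> i f) x = (\<Sum>i\<in>A. lin_ext (\<phi> i) x)"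
  by (simp add: lin_ext_def free.scale_sum_right sum.swap[of _ A])

lemma lin_ext_zero_fun [simp]: "lin_ext (\<lambda>f. 0) x = 0"
  by (simp add: lin_ext_def)

lemma lin_ext_times_right: "lin_ext \<phi> x * y = lin_ext (\<lambda>f. \<phi> f * y) x"
  by (simp add: lin_ext_def sum_distrib_right scale_mult_left)

lemma lin_ext_times_left: "y * lin_ext \<phi> x = lin_ext (\<lambda>f. y * \<phi> f) x"
  by (simp add: lin_ext_def sum_distrib_left scale_mult_right)

lemma lin_ext_mult_split:
  assumes "\<And>f g. \<chi> (f + g) = \<phi> f * \<psi> g"
  shows "lin_ext \<chi> (x * y) = lin_ext \<phi> x * lin_ext \<psi> y"
proof (induction x rule: basis_induct)
  case (basis f)
  show ?case
    by (induction y rule: basis_induct)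
      (simp_all add: mult_single assms distrib_left lin_ext_add lin_ext_scale scale_mult_right)
qed (simp_all add: distrib_right lin_ext_add lin_ext_scale scale_mult_left)

lemma lin_ext_derivation:
  assumes "\<And>f g. \<chi> (f + g) = \<chi> f * \<phi> g + \<phi> f * \<chi> g"
  shows "lin_ext \<chi> (x * y) = lin_ext \<chi> x * lin_ext \<phi> y + lin_ext \<phi> x * lin_ext \<chi> y"
proof (induction x rule: basis_induct)
  case (basis f)
  show ?case
    by (induction y rule: basis_induct)
      (simp_all add: mult_single assms distrib_left lin_ext_add lin_ext_scale scale_mult_right
        free.scale_right_distrib)
qed (simp_all add: distrib_right lin_ext_add lin_ext_scale scale_mult_left free.scale_right_distrib)

lemma keys_lin_ext:
  "Poly_Mapping.keys (lin_ext \<phi> x) \<subseteq> (\<Union>f\<in>Poly_Mapping.keys x. Poly_Mapping.keys (\<phi> f))"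
proof
  fix g assume "g \<in> Poly_Mapping.keys (lin_ext \<phi> x)"
  then have "(\<Sum>f\<in>Poly_Mapping.keys x. Poly_Mapping.lookup x f * Poly_Mapping.lookup (\<phi> f) g) \<noteq> 0"
    by (simp add: lin_ext_def in_keys_iff lookup_sum)
  then obtain f where "f \<in> Poly_Mapping.keys x" "Poly_Mapping.lookup x f * Poly_Mapping.lookup (\<phi> f) g \<noteq> 0"
    by (rule sum.not_neutral_contains_not_neutral)
  then show "g \<in> (\<Union>f\<in>Poly_Mapping.keys x. Poly_Mapping.keys (\<phi> f))"
    by (auto simp: in_keys_iff)
qed

lemma scale_eq_const_mult: "scale c x = Poly_Mapping.single 0 c * x"
  by (simp only: single_eq_scale[of 0 c] single_one scale_mult_left mult_1_left)

lemma const_central: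
  "Poly_Mapping.single 0 c * x = x * Poly_Mapping.single 0 (c::'k::field_char_0)"
  by (simp only: single_eq_scale[of 0 c] single_one scale_mult_left scale_mult_right
      mult_1_left mult_1_right)

lemma tensor_basis_vec [simp]: "tensor (basis_vec f) (basis_vec g) = basis_vec (f, g)"
  by (simp add: tensor_def)

lemma tensor_basis_vec_right: "tensor x (basis_vec g) = lin_ext (\<lambda>f. basis_vec (f, g)) x"
  by (simp add: tensor_def)

lemma tensor_basis_vec_left: "tensor (basis_vec f) y = lin_ext (\<lambda>g. basis_vec (f, g)) y"
  by (simp add: tensor_def)

lemma tensor_add_right: "tensor x (y + z) = tensor x y + tensor x z"
  by (simp add: tensor_def lin_ext_add lin_ext_add_fun)

lemma tensor_scale_right: "tensor x (scale c z) = scale c (tensor x z)"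
  by (simp add: tensor_def lin_ext_scale lin_ext_scale_fun)

lemma tensor_zero [simp]: "tensor 0 y = 0" "tensor x 0 = 0"
  by (simp_all add: tensor_def)

lemma lin_ext_tensor: "lin_ext \<phi> (tensor x y) = lin_ext (\<lambda>f. lin_ext (\<lambda>g. \<phi> (f, g)) y) x"
  by (simp add: tensor_def lin_ext_lin_ext)

lemma tensor_mult: "tensor x y * tensor x' y' = tensor (x * x') (y * y')"
proof (induction x rule: basis_induct)
  case (basis f)
  show ?case
  proof (induction y rule: basis_induct)
    case (basis g)
    show ?case
    proof (induction x' rule: basis_induct)
      case (basis f')
      show ?case
        by (induction y' rule: basis_induct)
          (simp_all add: mult_single distrib_left tensor_add_right tensor_scale_right scale_mult_right)
    qed (simp_all add: distrib_left tensor_add_left tensor_scale_left scale_mult_right)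
  qed (simp_all add: distrib_right tensor_add_right tensor_scale_right scale_mult_left)
qed (simp_all add: distrib_right tensor_add_left tensor_scale_left scale_mult_left)

lemma tensor_one_one: "tensor 1 1 = 1"
  using tensor_basis_vec[of 0 0] by (simp flip: zero_prod_def)

section \<open>Scalar power series evaluated at power series over a monoid algebra\<close>

text \<open>An infinite sum of power series in which the \<open>k\<close>-th summand is divisible by \<open>h\<^sup>k\<close>, so that only
  the summands \<open>k \<le> n\<close> contribute to the coefficient of \<open>h\<^sup>n\<close>. The truncation is part of the
  definition, which therefore has its intended meaning for \<open>locally_finite\<close> families only.\<close>

definition family_sum :: "(nat \<Rightarrow> 'a::ring_1 fps) \<Rightarrow> 'a fps" where
  "family_sum u = Abs_fps (\<lambda>n. \<Sum>k\<le>n. fps_nth (u k) n)"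

definition locally_finite :: "(nat \<Rightarrow> 'a::ring_1 fps) \<Rightarrow> bool" where
  "locally_finite u \<longleftrightarrow> (\<forall>k n. n < k \<longrightarrow> fps_nth (u k) n = 0)"

lemma family_sum_nth:
  assumes "locally_finite u" "n \<le> N"
  shows "fps_nth (family_sum u) n = (\<Sum>k\<le>N. fps_nth (u k) n)"
  unfolding family_sum_def fps_nth_Abs_fps
  by (rule sum.mono_neutral_left) (use assms in \<open>auto simp: locally_finite_def\<close>)

lemma fps_mult_nth_below:
  fixes f g :: "'a::ring_1 fps"
  assumes "\<And>i. i < j \<Longrightarrow> fps_nth f i = 0" "\<And>i. i < k \<Longrightarrow> fps_nth g i = 0" "n < j + k"
  shows "fps_nth (f * g) n = 0"
  unfolding fps_mult_nth
proof (intro sum.neutral ballI)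
  fix i assume "i \<in> {0..n}"
  then have "i < j \<or> n - i < k" using assms(3) by auto
  then show "fps_nth f i * fps_nth g (n - i) = 0" using assms(1,2) by auto
qed

lemma sum_square_triangle:
  fixes F :: "nat \<Rightarrow> nat \<Rightarrow> 'a::comm_monoid_add"
  assumes "\<And>i j. N < i + j \<Longrightarrow> F i j = 0"
  shows "(\<Sum>i\<le>N. \<Sum>j\<le>N. F i j) = (\<Sum>n\<le>N. \<Sum>i\<le>n. F i (n - i))"
proof -
  have "(\<Sum>i\<le>N. \<Sum>j\<le>N. F i j) = (\<Sum>(i,j)\<in>{..N}\<times>{..N}. F i j)"
    by (simp add: sum.cartesian_product)
  also have "\<dots> = (\<Sum>(i,j)\<in>{(i,j). i + j \<le> N}. F i j)"
    by (rule sum.mono_neutral_right) (use assms in \<open>auto simp flip: not_less\<close>)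
  also have "\<dots> = (\<Sum>n\<le>N. \<Sum>i\<le>n. F i (n - i))"
    by (rule sum.triangle_reindex_eq)
  finally show ?thesis .
qed

text \<open>The Cauchy product. Modulo \<open>h\<^bsup>N + 1\<^esup>\<close> both factors are finite sums over \<open>k \<le> N\<close>, and the products of
  summands with indices adding up to more than \<open>N\<close> vanish, so the square of index pairs may be cut
  down to a triangle.\<close>

lemma family_sum_mult:
  assumes u: "locally_finite u" and w: "locally_finite w"
  shows "family_sum u * family_sum w = family_sum (\<lambda>n. \<Sum>i\<le>n. u i * w (n - i))"
proof (rule fps_ext)
  fix N
  have "fps_nth (family_sum u * family_sum w) N =
        (\<Sum>i=0..N. (\<Sum>j\<le>N. fps_nth (u j) i) * (\<Sum>k\<le>N. fps_nth (w k) (N - i)))"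
    unfolding fps_mult_nth
    by (intro sum.cong refl) (simp add: family_sum_nth[OF u, of _ N] family_sum_nth[OF w, of _ N])
  also have "\<dots> = (\<Sum>i=0..N. \<Sum>j\<le>N. \<Sum>k\<le>N. fps_nth (u j) i * fps_nth (w k) (N - i))"
    by (simp add: sum_product)
  also have "\<dots> = (\<Sum>j\<le>N. \<Sum>i=0..N. \<Sum>k\<le>N. fps_nth (u j) i * fps_nth (w k) (N - i))"
    by (rule sum.swap)
  also have "\<dots> = (\<Sum>j\<le>N. \<Sum>k\<le>N. fps_nth (u j * w k) N)"
    unfolding fps_mult_nth by (intro sum.cong refl sum.swap)
  also have "\<dots> = (\<Sum>n\<le>N. \<Sum>i\<le>n. fps_nth (u i * w (n - i)) N)"
    by (rule sum_square_triangle, rule fps_mult_nth_below)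
      (use u w in \<open>auto simp: locally_finite_def\<close>)
  finally show "fps_nth (family_sum u * family_sum w) N =
      fps_nth (family_sum (\<lambda>n. \<Sum>i\<le>n. u i * w (n - i))) N"
    by (simp add: family_sum_def fps_sum_nth)
qed

lemma family_sum_mult_left:
  assumes "locally_finite u"
  shows "f * family_sum u = family_sum (\<lambda>k. f * u k)"
proof (rule fps_ext)
  fix N
  have "fps_nth (f * family_sum u) N = (\<Sum>i=0..N. fps_nth f i * (\<Sum>k\<le>N. fps_nth (u k) (N - i)))"
    by (simp only: fps_mult_nth family_sum_nth[OF assms diff_le_self])
  also have "\<dots> = (\<Sum>k\<le>N. \<Sum>i=0..N. fps_nth f i * fps_nth (u k) (N - i))"
    by (subst sum.swap) (simp add: sum_distrib_left)
  finally show "fps_nth (f * family_sum u) N = fps_nth (family_sum (\<lambda>k. f * u k)) N"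
    by (simp add: family_sum_def fps_mult_nth)
qed

lemma family_sum_mult_right:
  assumes "locally_finite u"
  shows "family_sum u * f = family_sum (\<lambda>k. u k * f)"
proof (rule fps_ext)
  fix N
  have "fps_nth (family_sum u * f) N = (\<Sum>i=0..N. (\<Sum>k\<le>N. fps_nth (u k) i) * fps_nth f (N - i))"
    unfolding fps_mult_nth by (intro sum.cong refl) (simp add: family_sum_nth[OF assms, of _ N])
  also have "\<dots> = (\<Sum>k\<le>N. \<Sum>i=0..N. fps_nth (u k) i * fps_nth f (N - i))"
    by (subst sum.swap) (simp add: sum_distrib_right)
  finally show "fps_nth (family_sum u * f) N = fps_nth (family_sum (\<lambda>k. u k * f)) N"
    by (simp add: family_sum_def fps_mult_nth)
qed

lemma fps_power_nth_below:
  fixes X :: "'a::ring_1 fps"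
  assumes "fps_nth X 0 = 0" "n < k"
  shows "fps_nth (X ^ k) n = 0"
  using assms(2)
proof (induction k arbitrary: n)
  case (Suc k)
  show ?case
    unfolding power_Suc by (rule fps_mult_nth_below[of 1 _ k]) (use Suc assms in auto)
qed simp

text \<open>Scalars enter the power series over a monoid algebra as constant series, which are central.\<close>

abbreviation scalar_fps :: "'k \<Rightarrow> ('f::monoid_add \<Rightarrow>\<^sub>0 'k::field_char_0) fps" where
  "scalar_fps c \<equiv> fps_const (Poly_Mapping.single 0 c)"

lemma scalar_fps_nth: "fps_nth (scalar_fps c * X) n = scale c (fps_nth X n)"
  by (simp add: scale_eq_const_mult)

lemma scalar_fps_commute: "scalar_fps c * X = X * scalar_fps c"
  by (rule fps_ext) (simp add: const_central)

lemma scalar_fps_mult: "scalar_fps (c * d) = scalar_fps c * scalar_fps d"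
  by (simp add: mult_single)

lemma scalar_fps_add: "scalar_fps (c + d) = scalar_fps c + scalar_fps d"
  by (simp add: single_add)

lemma scalar_fps_sum: "scalar_fps (\<Sum>i\<in>A. c i) = (\<Sum>i\<in>A. scalar_fps (c i))"
  by (induction A rule: infinite_finite_induct) (simp_all add: scalar_fps_add del: fps_const_add)

lemma scalar_fps_of_nat: "scalar_fps (of_nat n) = of_nat n"
  by (induction n) (simp_all add: scalar_fps_add single_add flip: single_one fps_const_add)

text \<open>The value \<open>P(X)\<close> of a scalar series at a series over a possibly noncommutative algebra; it is
  meaningful if \<open>X\<close> has constant term \<open>0\<close>. All values at one \<open>X\<close> commute with each other, because
  \<open>P \<mapsto> P(X)\<close> is a ring homomorphism out of a commutative ring.\<close>

definition fps_eval :: "('f::monoid_add \<Rightarrow>\<^sub>0 'k) fps \<Rightarrow> 'k::field_char_0 fps \<Rightarrow> ('f \<Rightarrow>\<^sub>0 'k) fps" where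
  "fps_eval X P = family_sum (\<lambda>k. scalar_fps (fps_nth P k) * X ^ k)"

lemma locally_finite_eval:
  "fps_nth X 0 = 0 \<Longrightarrow> locally_finite (\<lambda>k. scalar_fps (c k) * X ^ k)"
  by (simp add: locally_finite_def fps_power_nth_below)

lemma fps_eval_nth:
  assumes "fps_nth X 0 = 0" "n \<le> N"
  shows "fps_nth (fps_eval X P) n = (\<Sum>k\<le>N. scale (fps_nth P k) (fps_nth (X ^ k) n))"
  unfolding fps_eval_def
  by (subst family_sum_nth[OF locally_finite_eval, OF assms]) (simp add: scale_eq_const_mult)

lemma fps_eval_nth_self:
  "fps_nth (fps_eval X P) n = (\<Sum>k\<le>n. scale (fps_nth P k) (fps_nth (X ^ k) n))"
  by (simp add: fps_eval_def family_sum_def scale_eq_const_mult)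

lemma fps_eval_nth_0: "fps_nth (fps_eval X P) 0 = scale (fps_nth P 0) 1"
  by (simp add: fps_eval_nth_self)

lemma fps_eval_mult:
  assumes "fps_nth X 0 = 0"
  shows "fps_eval X (P * Q) = fps_eval X P * fps_eval X Q"
proof -
  have "(\<Sum>i\<le>n. scalar_fps (fps_nth P i) * X ^ i * (scalar_fps (fps_nth Q (n - i)) * X ^ (n - i))) =
        scalar_fps (fps_nth (P * Q) n) * X ^ n" for n
  proof -
    have "scalar_fps (fps_nth P i) * X ^ i * (scalar_fps (fps_nth Q (n - i)) * X ^ (n - i)) =
          scalar_fps (fps_nth P i * fps_nth Q (n - i)) * X ^ n" if "i \<le> n" for i
    proof -
      have "scalar_fps (fps_nth P i) * X ^ i * (scalar_fps (fps_nth Q (n - i)) * X ^ (n - i)) =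
            scalar_fps (fps_nth P i) * (X ^ i * scalar_fps (fps_nth Q (n - i))) * X ^ (n - i)"
        by (simp add: mult.assoc)
      also have "\<dots> = scalar_fps (fps_nth P i) * scalar_fps (fps_nth Q (n - i)) * (X ^ i * X ^ (n - i))"
        by (simp only: scalar_fps_commute[of "fps_nth Q (n - i)" "X ^ i", symmetric] mult.assoc)
      also have "\<dots> = scalar_fps (fps_nth P i * fps_nth Q (n - i)) * X ^ n"
        using that by (simp only: scalar_fps_mult power_add[symmetric]) simp
      finally show ?thesis .
    qed
    then show ?thesis
      by (simp only: fps_mult_nth atLeast0AtMost sum_distrib_right scalar_fps_sum)
        (intro sum.cong refl, simp del: fps_const_mult)
  qed
  then show ?thesis
    unfolding fps_eval_def by (simp add: family_sum_mult locally_finite_eval assms)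
qed

lemma fps_eval_diff: "fps_eval X (P - Q) = fps_eval X P - fps_eval X Q"
  by (rule fps_ext) (simp add: fps_eval_nth_self free.scale_left_diff_distrib sum_subtractf)

lemma fps_eval_const: "fps_eval X (fps_const c) = scalar_fps c"
proof (rule fps_ext)
  fix n
  have "fps_nth (fps_eval X (fps_const c)) n =
      (\<Sum>k\<le>n. if k = 0 then scale c (fps_nth 1 n) else 0)"
    unfolding fps_eval_nth_self by (intro sum.cong) auto
  then show "fps_nth (fps_eval X (fps_const c)) n = fps_nth (scalar_fps c) n"
    by (simp add: scale_eq_const_mult)
qed

lemma fps_eval_one: "fps_eval X 1 = 1"
  using fps_eval_const[of X 1] by simp

lemma fps_eval_X:
  assumes "fps_nth X 0 = 0" shows "fps_eval X fps_X = X"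
proof (rule fps_ext)
  fix n
  have "fps_nth (fps_eval X fps_X) n = (\<Sum>k\<le>Suc n. if k = 1 then fps_nth X n else 0)"
    unfolding fps_eval_nth[OF assms le_SucI[OF order_refl]] by (intro sum.cong) auto
  also have "\<dots> = fps_nth X n" by simp
  finally show "fps_nth (fps_eval X fps_X) n = fps_nth X n" .
qed

lemma fps_eval_power:
  "fps_nth X 0 = 0 \<Longrightarrow> fps_eval X (P ^ n) = fps_eval X P ^ n"
  by (induction n) (simp_all add: fps_eval_one fps_eval_mult)

lemma fps_power_nth_cong:
  fixes X Y :: "'a::ring_1 fps"
  assumes "\<And>i. i \<le> n \<Longrightarrow> fps_nth X i = fps_nth Y i"
  shows "fps_nth (X ^ k) n = fps_nth (Y ^ k) n"
  using assms
proof (induction k arbitrary: n)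
  case (Suc k)
  show ?case
    unfolding power_Suc fps_mult_nth
    by (intro sum.cong refl arg_cong2[of _ _ _ _ "(*)"] Suc.IH Suc.prems) auto
qed simp

text \<open>Causality: the coefficients of \<open>P(X)\<close> up to degree \<open>n\<close> see \<open>X\<close> only up to degree \<open>n\<close>. This makes
  solutions of fixed point equations \<open>X = h b(P(X))\<close> unique.\<close>

lemma fps_eval_nth_cong:
  assumes "\<And>i. i \<le> n \<Longrightarrow> fps_nth X i = fps_nth Y i"
  shows "fps_nth (fps_eval X P) n = fps_nth (fps_eval Y P) n"
  unfolding fps_eval_nth_self using fps_power_nth_cong[OF assms] by simp

lemma binomial_commuting:
  fixes a c :: "'a::ring_1"
  assumes "a * c = c * a"
  shows "(a + c) ^ n = (\<Sum>k\<le>n. of_nat (n choose k) * (a ^ (n - k) * c ^ k))"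
proof (induction n)
  case (Suc n)
  have comm: "c * a ^ m = a ^ m * c" for m
    using assms by (metis power_commuting_commutes)
  have ncomm: "x * (of_nat m * y) = of_nat m * (x * y)" for x y :: 'a and m
    by (metis mult.assoc mult_of_nat_commute)
  let ?t = "\<lambda>n k. a ^ (n - k) * c ^ k"
  have "(a + c) ^ Suc n = (\<Sum>k\<le>n. of_nat (n choose k) * (a * ?t n k)) +
          (\<Sum>k\<le>n. of_nat (n choose k) * (c * ?t n k))"
    unfolding power_Suc Suc distrib_right
    by (intro arg_cong2[of _ _ _ _ "(+)"]) (simp_all only: sum_distrib_left ncomm)
  also have "(\<Sum>k\<le>n. of_nat (n choose k) * (a * ?t n k)) =
             (\<Sum>k\<le>n. of_nat (n choose k) * ?t (Suc n) k)"
    by (intro sum.cong refl) (simp add: Suc_diff_le flip: mult.assoc)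
  also have "\<dots> = (\<Sum>k\<le>Suc n. of_nat (n choose k) * ?t (Suc n) k)"
    by (simp add: binomial_eq_0)
  also have "(\<Sum>k\<le>n. of_nat (n choose k) * (c * ?t n k)) =
             (\<Sum>k\<le>n. of_nat (n choose k) * ?t (Suc n) (Suc k))"
    by (intro sum.cong refl) (simp only: diff_Suc_Suc power_Suc mult.assoc[symmetric] comm)
  also have "(\<Sum>k\<le>Suc n. of_nat (n choose k) * ?t (Suc n) k) + \<dots> =
       (\<Sum>k\<le>Suc n. of_nat (Suc n choose k) * ?t (Suc n) k)"
    by (simp only: sum.atMost_Suc_shift[of _ n] binomial_Suc_Suc of_nat_add distrib_right
        sum.distrib binomial_n_0 add.assoc) (simp only: add_ac)
  finally show ?case .
qed simp

lemma power_mult_commuting: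
  fixes a b :: "'a::monoid_mult"
  assumes "a * b = b * a"
  shows "(a * b) ^ n = a ^ n * b ^ n"
proof (induction n)
  case (Suc n)
  have "b * a ^ n = a ^ n * b"
    by (rule power_commuting_commutes[OF assms, symmetric])
  then show ?case
    by (simp add: Suc mult.assoc) (simp flip: mult.assoc)
qed simp

text \<open>The series \<open>P\<^bsup>(k)\<^esup> / k!\<close>, the coefficient of \<open>y\<^sup>k\<close> in \<open>P(x + y)\<close>.\<close>

definition hasse_deriv :: "nat \<Rightarrow> 'k::field_char_0 fps \<Rightarrow> 'k fps" where
  "hasse_deriv k P = Abs_fps (\<lambda>m. of_nat ((m + k) choose k) * fps_nth P (m + k))"

text \<open>Taylor expansion at commuting elements of a noncommutative ring: the binomial theorem, with the terms
  regrouped according to the exponent of \<open>C\<close>.\<close>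

lemma fps_eval_taylor:
  assumes comm: "A * C = C * A" and A: "fps_nth A 0 = 0" and C: "fps_nth C 0 = 0"
  shows "fps_eval (A + C) P = family_sum (\<lambda>k. fps_eval A (hasse_deriv k P) * C ^ k)"
proof (rule fps_ext)
  fix N
  let ?F = "\<lambda>k m. scale (of_nat ((m + k) choose k) * fps_nth P (m + k)) (fps_nth (A ^ m * C ^ k) N)"
  have ord: "fps_nth (A ^ m * C ^ k) N = 0" if "N < m + k" for m k
    by (rule fps_mult_nth_below[OF _ _ that]) (auto intro: fps_power_nth_below A C)
  have "fps_nth (fps_eval (A + C) P) N =
      (\<Sum>n\<le>N. \<Sum>k\<le>n. scale (fps_nth P n) (fps_nth (of_nat (n choose k) * (A ^ (n - k) * C ^ k)) N))"
    by (simp add: fps_eval_nth_self binomial_commuting[OF comm] fps_sum_nth free.scale_sum_right)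
  also have "\<dots> = (\<Sum>n\<le>N. \<Sum>k\<le>n. ?F k (n - k))"
    unfolding scalar_fps_of_nat[symmetric] scalar_fps_nth
    by (intro sum.cong refl) (simp add: mult.commute)
  also have "\<dots> = (\<Sum>k\<le>N. \<Sum>m\<le>N. ?F k m)"
    by (rule sum_square_triangle[symmetric]) (simp add: ord add.commute)
  also have "\<dots> = (\<Sum>k\<le>N. fps_nth (fps_eval A (hasse_deriv k P) * C ^ k) N)"
  proof (intro sum.cong refl)
    fix k
    have "fps_nth (fps_eval A (hasse_deriv k P) * C ^ k) N =
      (\<Sum>i=0..N. (\<Sum>m\<le>N. scale (fps_nth (hasse_deriv k P) m) (fps_nth (A ^ m) i)) * fps_nth (C ^ k) (N - i))"
      unfolding fps_mult_nth by (intro sum.cong refl) (simp add: fps_eval_nth[OF A, of _ N])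
    also have "\<dots> = (\<Sum>m\<le>N. \<Sum>i=0..N. scale (fps_nth (hasse_deriv k P) m) (fps_nth (A ^ m) i * fps_nth (C ^ k) (N - i)))"
      by (subst sum.swap) (simp add: sum_distrib_right scale_mult_left)
    also have "\<dots> = (\<Sum>m\<le>N. ?F k m)"
      by (simp add: fps_mult_nth free.scale_sum_right hasse_deriv_def)
    finally show "(\<Sum>m\<le>N. ?F k m) = fps_nth (fps_eval A (hasse_deriv k P) * C ^ k) N" ..
  qed
  finally show "fps_nth (fps_eval (A + C) P) N =
      fps_nth (family_sum (\<lambda>k. fps_eval A (hasse_deriv k P) * C ^ k)) N"
    by (simp add: family_sum_def)
qed

section \<open>The differential equation and its formal group law\<close>

text \<open>The differential equation determines \<open>P\<close> from its constant term through this recurrence, which is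
  the form in which the equation is derived from a Hopf subalgebra and compared with closed forms.\<close>

lemma ode_iff_recurrence:
  fixes P :: "'k::field_char_0 fps"
  shows "(1 - fps_const \<gamma> * fps_X) * fps_deriv P = fps_const \<alpha> * P \<longleftrightarrow>
    (\<forall>n. of_nat (Suc n) * fps_nth P (Suc n) = (\<alpha> + of_nat n * \<gamma>) * fps_nth P n)"
proof -
  have "fps_nth ((1 - fps_const \<gamma> * fps_X) * fps_deriv P) n =
      of_nat (Suc n) * fps_nth P (Suc n) - of_nat n * \<gamma> * fps_nth P n" for n
    by (cases n) (simp_all add: algebra_simps)
  then show ?thesis
    by (simp add: fps_eq_iff algebra_simps)
qed

lemma fps_deriv_hasse_deriv:
  "fps_deriv (hasse_deriv k P) = of_nat (Suc k) * hasse_deriv (Suc k) P"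
proof (rule fps_ext)
  fix m
  have "Suc m * ((Suc m + k) choose k) = Suc k * ((Suc m + k) choose Suc k)"
    using binomial_absorb_comp[of "Suc m + k" k] binomial_absorption[of k "Suc m + k"] by simp
  then have eq: "(of_nat (Suc m) * of_nat ((Suc m + k) choose k) :: 'a) =
      of_nat (Suc k) * of_nat ((Suc m + k) choose Suc k)"
    by (simp only: of_nat_mult[symmetric])
  have "fps_nth (fps_deriv (hasse_deriv k P)) m =
      of_nat (Suc m) * of_nat ((Suc m + k) choose k) * fps_nth P (Suc m + k)"
    by (simp add: hasse_deriv_def del: of_nat_Suc binomial_Suc_Suc flip: mult.assoc)
  also have "\<dots> = of_nat (Suc k) * (of_nat ((m + Suc k) choose Suc k) * fps_nth P (m + Suc k))"
    by (simp only: eq) (simp only: mult.assoc add_Suc add_Suc_right)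
  finally show "fps_nth (fps_deriv (hasse_deriv k P)) m = fps_nth (of_nat (Suc k) * hasse_deriv (Suc k) P) m"
    unfolding fps_of_nat[symmetric] by (simp only: hasse_deriv_def fps_mult_left_const_nth fps_nth_Abs_fps)
qed

text \<open>With \<open>\<gamma> = \<alpha> \<beta>\<close> and \<open>\<beta> \<noteq> 0\<close> the solution is \<open>(1 - \<gamma> x)\<close> to the power \<open>-1/\<beta>\<close>, and its \<open>k\<close>-th derivative is a
  constant multiple of \<open>(1 - \<gamma> x)\<close> to the power \<open>-1/\<beta> - k\<close>. The induction differentiates the equation for
  \<open>k\<close>, which avoids closed forms and with them the case distinction on \<open>\<beta>\<close>.\<close>

lemma hasse_deriv_ode:
  fixes P :: "'k::field_char_0 fps"
  assumes "(1 - fps_const \<gamma> * fps_X) * fps_deriv P = fps_const \<alpha> * P" and "fps_nth P 0 = 1"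
  shows "(1 - fps_const \<gamma> * fps_X) ^ k * hasse_deriv k P = fps_const (fps_nth P k) * P"
proof (induction k)
  case 0
  have "hasse_deriv 0 P = P" by (rule fps_ext) (simp add: hasse_deriv_def)
  then show ?case using assms by simp
next
  case (Suc k)
  define L where "L = 1 - fps_const \<gamma> * fps_X"
  have L: "L * fps_deriv P = fps_const \<alpha> * P" "L ^ k * hasse_deriv k P = fps_const (fps_nth P k) * P"
      "fps_deriv L = - fps_const \<gamma>"
    using assms(1) Suc by (simp_all add: L_def)
  have "fps_deriv (L ^ k * hasse_deriv k P) * L = fps_const (fps_nth P k) * (L * fps_deriv P)"
    unfolding L(2) by (simp add: mult_ac)
  then have 1: "fps_deriv (L ^ k * hasse_deriv k P) * L = fps_const (fps_nth P k * \<alpha>) * P"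
    by (simp only: L(1) mult.assoc fps_const_mult[symmetric])
  have 2: "fps_deriv (L ^ k) * L = - of_nat k * fps_const \<gamma> * L ^ k"
  proof (cases k)
    case (Suc j)
    have "fps_deriv (L ^ k) = of_nat k * - fps_const \<gamma> * L ^ j"
      using Suc by (simp only: L fps_deriv_power diff_Suc_1 fps_of_nat)
    then show ?thesis
      by (simp only: Suc power_Suc mult.assoc mult.commute[of "L ^ j"] mult_minus_left mult_minus_right)
  qed simp
  have "fps_deriv (L ^ k * hasse_deriv k P) * L =
      L ^ Suc k * fps_deriv (hasse_deriv k P) + (fps_deriv (L ^ k) * L) * hasse_deriv k P"
    by (simp add: algebra_simps)
  also have "\<dots> = of_nat (Suc k) * (L ^ Suc k * hasse_deriv (Suc k) P)
      - of_nat k * fps_const \<gamma> * (L ^ k * hasse_deriv k P)"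
    unfolding 2 fps_deriv_hasse_deriv by (simp add: algebra_simps)
  finally have "of_nat (Suc k) * (L ^ Suc k * hasse_deriv (Suc k) P) =
      fps_const (fps_nth P k * \<alpha>) * P + of_nat k * fps_const \<gamma> * (fps_const (fps_nth P k) * P)"
    unfolding 1 unfolding L(2) by (simp add: algebra_simps)
  also have "\<dots> = fps_const ((\<alpha> + of_nat k * \<gamma>) * fps_nth P k) * P"
    by (simp add: algebra_simps flip: fps_const_mult fps_const_add fps_of_nat)
  also have "(\<alpha> + of_nat k * \<gamma>) * fps_nth P k = of_nat (Suc k) * fps_nth P (Suc k)"
    using assms(1) unfolding ode_iff_recurrence by simp
  also have "fps_const (of_nat (Suc k) * fps_nth P (Suc k)) * P =
      of_nat (Suc k) * (fps_const (fps_nth P (Suc k)) * P)"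
    by (simp only: fps_const_mult[symmetric] fps_of_nat mult.assoc)
  finally show ?case
    unfolding L_def by (metis mult_left_cancel of_nat_eq_0_iff nat.distinct(1))
qed

text \<open>The functional equation \<open>P(x + y - \<gamma> x y) = P(x) P(y)\<close>: for \<open>\<gamma> \<noteq> 0\<close> it reflects
  \<open>1 - \<gamma> (x + y - \<gamma> x y) = (1 - \<gamma> x) (1 - \<gamma> y)\<close>, for \<open>\<gamma> = 0\<close> it is the one of the exponential
  series. Writing the argument as \<open>x + (1 - \<gamma> x) y\<close>, the powers of \<open>1 - \<gamma> x\<close> cancel the denominators
  of the Taylor coefficients.\<close>

lemma fps_eval_ode:
  fixes P :: "'k::field_char_0 fps"
  assumes ode: "(1 - fps_const \<gamma> * fps_X) * fps_deriv P = fps_const \<alpha> * P" "fps_nth P 0 = 1"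
    and comm: "A * T = T * A" and A: "fps_nth A 0 = 0" and T: "fps_nth T 0 = 0"
  shows "fps_eval (A + (1 - scalar_fps \<gamma> * A) * T) P = fps_eval A P * fps_eval T P"
proof -
  let ?L = "1 - scalar_fps \<gamma> * A"
  have L: "fps_eval A (1 - fps_const \<gamma> * fps_X) = ?L"
    by (simp add: fps_eval_diff fps_eval_one fps_eval_mult fps_eval_const fps_eval_X A)
  have comm': "scalar_fps \<gamma> * A * T = T * (scalar_fps \<gamma> * A)"
    by (metis mult.assoc comm scalar_fps_commute)
  have LT: "?L * T = T * ?L"
    by (simp add: left_diff_distrib right_diff_distrib comm')
  have AL: "A * ?L = ?L * A"
    by (simp add: left_diff_distrib right_diff_distrib) (metis mult.assoc scalar_fps_commute)
  have "A * (?L * T) = A * ?L * T"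
    by (simp only: mult.assoc)
  also have "\<dots> = ?L * (A * T)"
    by (simp only: AL mult.assoc)
  also have "\<dots> = ?L * T * A"
    by (simp only: comm mult.assoc)
  finally have "fps_eval (A + ?L * T) P = family_sum (\<lambda>k. fps_eval A (hasse_deriv k P) * (?L * T) ^ k)"
    by (intro fps_eval_taylor) (simp_all add: A T)
  also have "\<dots> = family_sum (\<lambda>k. fps_eval A P * (scalar_fps (fps_nth P k) * T ^ k))"
  proof (rule arg_cong[of _ _ family_sum], rule ext)
    fix k
    have "(?L * T) ^ k = ?L ^ k * T ^ k"
      by (rule power_mult_commuting[OF LT])
    then have "fps_eval A (hasse_deriv k P) * (?L * T) ^ k =
        fps_eval A (hasse_deriv k P * (1 - fps_const \<gamma> * fps_X) ^ k) * T ^ k"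
      by (simp add: fps_eval_mult fps_eval_power A L mult.assoc)
    also have "hasse_deriv k P * (1 - fps_const \<gamma> * fps_X) ^ k = P * fps_const (fps_nth P k)"
      using hasse_deriv_ode[OF ode, of k] by (simp add: mult.commute)
    finally show "fps_eval A (hasse_deriv k P) * (?L * T) ^ k =
        fps_eval A P * (scalar_fps (fps_nth P k) * T ^ k)"
      by (simp add: fps_eval_mult fps_eval_const A mult.assoc)
  qed
  also have "\<dots> = fps_eval A P * fps_eval T P"
    unfolding fps_eval_def[of T]
    by (rule family_sum_mult_left[OF locally_finite_eval[OF T], symmetric])
  finally show ?thesis .
qed

lemma mult_map_tensor: "mult_map (tensor x y) = x * y"
  unfolding mult_map_def lin_ext_tensor prod.case
  by (simp flip: lin_ext_times_left lin_ext_times_right)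

lemma mult_map_tensor_map:
  "mult_map (tensor_map (lin_ext U) (lin_ext V) t) = lin_ext (\<lambda>(f, g). U f * V g) t"
proof -
  have "mult_map (tensor_map (lin_ext U) (lin_ext V) t) =
      lin_ext (\<lambda>(f, g). mult_map (tensor (U f) (V g))) t"
    by (simp add: tensor_map_def mult_map_def lin_ext_lin_ext case_prod_unfold)
  then show ?thesis by (simp only: mult_map_tensor)
qed

section \<open>Bialgebras of forests\<close>

text \<open>What the commutative and the planar case have in common. The forests form a monoid which is generated
  by grafting from the empty forest; \<open>len\<close> counts the trees of a forest. The coproduct is multiplicative,
  and on trees it is given by the recursion that characterises it. Stating this with functions on forests
  instead of linear maps lets every linear map below be a \<open>lin_ext\<close>, determined by its values on the basis.\<close>

locale forest_bialgebra =
  fixes graft :: "'f::monoid_add \<Rightarrow> 'f"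
    and weight len :: "'f \<Rightarrow> nat"
    and cop :: "'f \<Rightarrow> (('f \<times> 'f) \<Rightarrow>\<^sub>0 'k::field_char_0)"
  assumes forest_induct [case_names empty graft add]:
      "\<And>Q F. Q 0 \<Longrightarrow> (\<And>G. Q G \<Longrightarrow> Q (graft G)) \<Longrightarrow> (\<And>G H. Q G \<Longrightarrow> Q H \<Longrightarrow> Q (G + H)) \<Longrightarrow> Q F"
    and graft_inject: "graft F = graft G \<Longrightarrow> F = G"
    and weight_add: "weight (F + G) = weight F + weight G"
    and weight_graft: "weight (graft F) = Suc (weight F)"
    and len_add: "len (F + G) = len F + len G"
    and len_graft: "len (graft F) = 1"
    and cop_zero: "cop 0 = 1"
    and cop_add: "cop (F + G) = cop F * cop G"
    and cop_graft: "cop (graft F) =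
      basis_vec (graft F, 0) + lin_ext (\<lambda>(f, g). basis_vec (f, graft g)) (cop F)"
begin

abbreviation Bplus :: "('f \<Rightarrow>\<^sub>0 'k) \<Rightarrow> ('f \<Rightarrow>\<^sub>0 'k)" where
  "Bplus \<equiv> lin_ext (\<lambda>F. basis_vec (graft F))"

abbreviation coproduct :: "('f \<Rightarrow>\<^sub>0 'k) \<Rightarrow> (('f \<times> 'f) \<Rightarrow>\<^sub>0 'k)" where
  "coproduct \<equiv> lin_ext cop"

lemma weight_zero [simp]: "weight 0 = 0"
  using weight_add[of 0 0] by simp

lemma len_zero [simp]: "len 0 = 0"
  using len_add[of 0 0] by simp

lemma weight_eq_0_iff [simp]: "weight F = 0 \<longleftrightarrow> F = 0"
proof
  show "weight F = 0 \<Longrightarrow> F = 0"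
    by (induction F rule: forest_induct) (simp_all add: weight_add weight_graft)
qed simp

lemma len_le_weight: "len F \<le> weight F"
  by (induction F rule: forest_induct) (simp_all add: weight_add weight_graft len_add len_graft)

lemma len_eq_0_iff [simp]: "len F = 0 \<longleftrightarrow> F = 0"
proof
  show "len F = 0 \<Longrightarrow> F = 0"
    by (induction F rule: forest_induct) (simp_all add: len_add len_graft)
qed simp

lemma graft_neq_zero [simp]: "graft F \<noteq> 0"
  by (metis len_graft len_zero zero_neq_one)

lemma add_eq_0_iff_forest [simp]: "F + G = 0 \<longleftrightarrow> F = 0 \<and> G = (0::'f)"
  by (metis add_is_0 weight_add weight_eq_0_iff)

lemma coproduct_one: "coproduct 1 = 1"
  by (simp add: cop_zero flip: single_one)

lemma coproduct_mult: "coproduct (x * y) = coproduct x * coproduct y"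
  by (rule lin_ext_mult) (rule cop_add)

lemma coproduct_Bplus:
  "coproduct (Bplus x) = tensor (Bplus x) 1 + lin_ext (\<lambda>(f, g). basis_vec (f, graft g)) (coproduct x)"
proof -
  have "tensor (Bplus x) (1 :: 'f \<Rightarrow>\<^sub>0 'k) = lin_ext (\<lambda>F. basis_vec (graft F, 0)) x"
    using tensor_basis_vec_right[of "Bplus x" 0] by (simp add: lin_ext_lin_ext)
  then show ?thesis
    by (simp add: lin_ext_lin_ext cop_graft lin_ext_add_fun)
qed

lemma weight_keys_cop: "(f, g) \<in> Poly_Mapping.keys (cop F) \<Longrightarrow> weight f + weight g = weight F"
proof (induction F arbitrary: f g rule: forest_induct)
  case empty
  then show ?case by (simp add: cop_zero zero_prod_def)
next
  case (graft F)
  from graft.prems have "(f, g) \<in> Poly_Mapping.keys (basis_vec (graft F, 0::'f) :: _ \<Rightarrow>\<^sub>0 'k) \<union>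
      Poly_Mapping.keys (lin_ext (\<lambda>(f, g). basis_vec (f, graft g)) (cop F))"
    unfolding cop_graft by (rule subsetD[OF Poly_Mapping.keys_add])
  moreover have "Poly_Mapping.keys (lin_ext (\<lambda>(f, g). basis_vec (f, graft g)) (cop F)) \<subseteq>
      (\<lambda>(f, g). (f, graft g)) ` Poly_Mapping.keys (cop F)"
    by (rule order_trans[OF keys_lin_ext]) force
  ultimately show ?case
    using graft.IH by (auto simp: weight_graft split: if_splits)
next
  case (add F G)
  obtain f1 g1 f2 g2 where "(f1, g1) \<in> Poly_Mapping.keys (cop F)" "(f2, g2) \<in> Poly_Mapping.keys (cop G)"
      "f = f1 + f2" "g = g1 + g2"
    using add.prems keys_mult[of "cop F" "cop G"] unfolding cop_add by auto
  with add.IH(1)[of f1 g1] add.IH(2)[of f2 g2] show ?case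
    by (simp add: weight_add)
qed

lemma left_counit:
  "lin_ext (\<lambda>(f, g). if f = 0 then basis_vec g else 0) (cop F) = basis_vec F"
proof (induction F rule: forest_induct)
  case empty
  show ?case using lin_ext_single[of _ "(0,0)"] by (simp add: cop_zero zero_prod_def flip: single_one)
next
  case (graft F)
  have "lin_ext (\<lambda>(f, g). if f = 0 then basis_vec g else 0) (cop (graft F)) =
      lin_ext (\<lambda>(f, g). if f = 0 then basis_vec (graft g) else 0) (cop F)"
    by (simp add: cop_graft lin_ext_add lin_ext_lin_ext case_prod_unfold cong: if_cong)
  also have "\<dots> = Bplus (lin_ext (\<lambda>(f, g). if f = 0 then basis_vec g else 0) (cop F))"
    by (simp add: lin_ext_lin_ext case_prod_unfold if_distrib cong: if_cong)
  finally show ?case by (simp add: graft)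
next
  case (add F G)
  have "lin_ext (\<lambda>(f, g). if f = 0 then basis_vec g else 0) (cop F * cop G) =
      lin_ext (\<lambda>(f, g). if f = 0 then basis_vec g else 0) (cop F) *
      lin_ext (\<lambda>(f, g). if f = 0 then basis_vec g else 0) (cop G)"
    by (rule lin_ext_mult) (auto simp: mult_single)
  then show ?case by (simp add: cop_add add mult_single)
qed

lemma right_counit:
  "lin_ext (\<lambda>(f, g). if g = 0 then basis_vec f else 0) (cop F) = basis_vec F"
proof (induction F rule: forest_induct)
  case empty
  show ?case using lin_ext_single[of _ "(0,0)"] by (simp add: cop_zero zero_prod_def flip: single_one)
next
  case (graft F)
  show ?case
    by (simp add: cop_graft lin_ext_add lin_ext_lin_ext case_prod_unfold)
next
  case (add F G)
  have "lin_ext (\<lambda>(f, g). if g = 0 then basis_vec f else 0) (cop F * cop G) =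
      lin_ext (\<lambda>(f, g). if g = 0 then basis_vec f else 0) (cop F) *
      lin_ext (\<lambda>(f, g). if g = 0 then basis_vec f else 0) (cop G)"
    by (rule lin_ext_mult) (auto simp: mult_single)
  then show ?case by (simp add: cop_add add mult_single)
qed

text \<open>Both sides are multiplicative in \<open>F\<close>, and on a tree both satisfy the same recursion: they add the
  term \<open>B\<^sup>+(F) \<otimes> 1 \<otimes> 1\<close> and the terms \<open>f \<otimes> B\<^sup>+(g) \<otimes> 1\<close>, for the terms \<open>f \<otimes> g\<close> of the
  coproduct of the branches \<open>F\<close>, to the image of their value at \<open>F\<close> under \<open>id \<otimes> id \<otimes> B\<^sup>+\<close>.\<close>

lemma coassociativity:
  "lin_ext (\<lambda>(f, g). lin_ext (\<lambda>(f1, f2). basis_vec (f1, f2, g)) (cop f)) (cop F) =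
   lin_ext (\<lambda>(f, g). lin_ext (\<lambda>(g1, g2). basis_vec (f, g1, g2)) (cop g)) (cop F)"
  (is "lin_ext ?l (cop F) = lin_ext ?r (cop F)")
proof (induction F rule: forest_induct)
  case empty
  have "lin_ext ?l (basis_vec (0, 0)) = lin_ext ?r (basis_vec (0, 0))"
    unfolding lin_ext_single prod.case cop_zero single_one[symmetric] zero_prod_def ..
  then show ?case
    by (simp add: cop_zero zero_prod_def flip: single_one)
next
  case (graft F)
  define B2 where "B2 = lin_ext (\<lambda>(f::'f, g). basis_vec (f, graft g) :: _ \<Rightarrow>\<^sub>0 'k)"
  define B3 where "B3 = lin_ext (\<lambda>(f::'f, g::'f, h). basis_vec (f, g, graft h) :: _ \<Rightarrow>\<^sub>0 'k)"
  have "lin_ext ?l (B2 (cop F)) = B3 (lin_ext ?l (cop F))"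
    by (simp add: B2_def B3_def lin_ext_lin_ext case_prod_unfold)
  then have l: "lin_ext ?l (cop (graft F)) = basis_vec (graft F, 0, 0) +
      lin_ext (\<lambda>(f, g). basis_vec (f, graft g, 0)) (cop F) + B3 (lin_ext ?l (cop F))"
    by (simp add: cop_graft lin_ext_add B2_def lin_ext_lin_ext case_prod_unfold)
  have "lin_ext ?r (basis_vec (graft F, 0)) = basis_vec (graft F, 0, 0)"
    unfolding lin_ext_single prod.case cop_zero by (simp add: zero_prod_def flip: single_one)
  moreover have "lin_ext ?r (B2 (cop F)) =
      lin_ext (\<lambda>(f, g). basis_vec (f, graft g, 0)) (cop F) + B3 (lin_ext ?r (cop F))"
    by (simp add: B2_def B3_def lin_ext_lin_ext case_prod_unfold cop_graft lin_ext_add lin_ext_add_fun)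
  ultimately have r: "lin_ext ?r (cop (graft F)) = basis_vec (graft F, 0, 0) +
      (lin_ext (\<lambda>(f, g). basis_vec (f, graft g, 0)) (cop F) + B3 (lin_ext ?r (cop F)))"
    by (simp only: cop_graft lin_ext_add B2_def)
  show ?case
    by (simp only: l r graft add.assoc)
next
  case (add F G)
  have "lin_ext ?l (x * y) = lin_ext ?l x * lin_ext ?l y" for x y
  proof (rule lin_ext_mult)
    fix p q :: "'f \<times> 'f"
    obtain f g f' g' where pq: "p = (f, g)" "q = (f', g')"
      by (cases p, cases q)
    have "lin_ext (\<lambda>(f1, f2). basis_vec (f1, f2, g + g')) (cop f * cop f') =
      lin_ext (\<lambda>(f1, f2). basis_vec (f1, f2, g)) (cop f) *
      (lin_ext (\<lambda>(f1, f2). basis_vec (f1, f2, g')) (cop f') :: _ \<Rightarrow>\<^sub>0 'k)"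
      by (rule lin_ext_mult_split) (auto simp: mult_single)
    then show "?l (p + q) = ?l p * ?l q"
      by (simp add: pq cop_add)
  qed
  moreover have "lin_ext ?r (x * y) = lin_ext ?r x * lin_ext ?r y" for x y
  proof (rule lin_ext_mult)
    fix p q :: "'f \<times> 'f"
    obtain f g f' g' where pq: "p = (f, g)" "q = (f', g')"
      by (cases p, cases q)
    have "lin_ext (\<lambda>(g1, g2). basis_vec (f + f', g1, g2)) (cop g * cop g') =
      lin_ext (\<lambda>(g1, g2). basis_vec (f, g1, g2)) (cop g) *
      (lin_ext (\<lambda>(g1, g2). basis_vec (f', g1, g2)) (cop g') :: _ \<Rightarrow>\<^sub>0 'k)"
      by (rule lin_ext_mult_split) (auto simp: mult_single)
    then show "?r (p + q) = ?r p * ?r q"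
      by (simp add: pq cop_add)
  qed
  ultimately show ?case by (simp only: cop_add add)
qed

section \<open>The antipode\<close>

text \<open>The convolution product of two linear maps, which are represented by their values on forests.\<close>

definition conv :: "('f \<Rightarrow> ('f \<Rightarrow>\<^sub>0 'k)) \<Rightarrow> ('f \<Rightarrow> ('f \<Rightarrow>\<^sub>0 'k)) \<Rightarrow> 'f \<Rightarrow> ('f \<Rightarrow>\<^sub>0 'k)" where
  "conv U V F = lin_ext (\<lambda>(f, g). U f * V g) (cop F)"

definition conv_unit :: "'f \<Rightarrow> ('f \<Rightarrow>\<^sub>0 'k)" where
  "conv_unit F = (if F = 0 then 1 else 0)"

lemma lin_ext_conv_unit: "lin_ext conv_unit x = scale (counit x) 1"
  by (induction x rule: basis_induct)
    (auto simp: conv_unit_def counit_def lookup_single lookup_add lin_ext_add lin_ext_scale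
      free.scale_left_distrib when_def)

definition augmented :: "'f \<Rightarrow> ('f \<Rightarrow>\<^sub>0 'k)" where
  "augmented F = (if F = 0 then 0 else basis_vec F)"

lemma conv_unit_left: "conv conv_unit U = U"
proof (rule ext)
  fix F
  have "conv conv_unit U F = lin_ext U (lin_ext (\<lambda>(f, g). if f = 0 then basis_vec g else 0) (cop F))"
    by (simp add: conv_def conv_unit_def lin_ext_lin_ext case_prod_unfold if_distrib
        cong: if_cong) (rule lin_ext_cong, simp)
  then show "conv conv_unit U F = U F" by (simp add: left_counit)
qed

lemma conv_unit_right: "conv U conv_unit = U"
proof (rule ext)
  fix F
  have "conv U conv_unit F = lin_ext U (lin_ext (\<lambda>(f, g). if g = 0 then basis_vec f else 0) (cop F))"
    by (simp add: conv_def conv_unit_def lin_ext_lin_ext case_prod_unfold if_distrib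
        cong: if_cong)
  then show "conv U conv_unit F = U F" by (simp add: right_counit)
qed

lemma conv_assoc: "conv (conv U V) W = conv U (conv V W)"
proof (rule ext)
  fix F
  have "conv (conv U V) W F = lin_ext (\<lambda>(f, g, h). U f * V g * W h)
      (lin_ext (\<lambda>(f, g). lin_ext (\<lambda>(f1, f2). basis_vec (f1, f2, g)) (cop f)) (cop F))"
    by (simp add: conv_def lin_ext_lin_ext case_prod_unfold lin_ext_times_right)
  also have "\<dots> = conv U (conv V W) F"
    unfolding coassociativity
    by (simp add: conv_def lin_ext_lin_ext case_prod_unfold lin_ext_times_left mult.assoc)
  finally show "conv (conv U V) W F = conv U (conv V W) F" .
qed

primrec conv_power :: "('f \<Rightarrow> ('f \<Rightarrow>\<^sub>0 'k)) \<Rightarrow> nat \<Rightarrow> 'f \<Rightarrow> ('f \<Rightarrow>\<^sub>0 'k)" where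
  "conv_power U 0 = conv_unit"
| "conv_power U (Suc n) = conv (conv_power U n) U"

lemma conv_power_commute: "conv U (conv_power U n) = conv (conv_power U n) U"
  by (induction n) (simp_all add: conv_unit_left conv_unit_right flip: conv_assoc)

text \<open>A nonzero summand of the \<open>n\<close>-fold convolution power cuts \<open>F\<close> into \<open>n\<close> nonempty forests, so it
  needs weight at least \<open>n\<close>.\<close>

lemma conv_power_augmented_eq_0: "weight F < n \<Longrightarrow> conv_power augmented n F = 0"
proof (induction n arbitrary: F)
  case (Suc n)
  have "conv_power augmented (Suc n) F = lin_ext (\<lambda>_. 0) (cop F)"
    unfolding conv_power.simps conv_def
  proof (rule lin_ext_cong, clarify)
    fix f g assume "(f, g) \<in> Poly_Mapping.keys (cop F)"
    then have "weight f + weight g = weight F" by (rule weight_keys_cop)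
    then have "weight f < n \<or> g = 0"
      using Suc.prems weight_eq_0_iff[of g] by linarith
    then show "conv_power augmented n f * augmented g = 0"
      using Suc.IH by (auto simp: augmented_def[of g])
  qed
  then show ?case by simp
qed simp

text \<open>The identity is \<open>e + J\<close>, with \<open>e\<close> the convolution unit and \<open>J\<close> the projection \<open>augmented\<close> on
  the augmentation ideal; its convolution inverse is the geometric series \<open>\<Sum>\<^sub>n (-1)\<^sup>n J\<^sup>n\<close>, which is
  a finite sum on each forest. Unlike a recursive definition on trees, the series shows at once that the
  antipode preserves every subalgebra on which the coproduct restricts.\<close>

definition antipode :: "'f \<Rightarrow> ('f \<Rightarrow>\<^sub>0 'k)" where
  "antipode F = (\<Sum>n\<le>weight F. scale ((- 1) ^ n) (conv_power augmented n F))"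

lemma antipode_eq:
  "weight F \<le> N \<Longrightarrow> antipode F = (\<Sum>n\<le>N. scale ((- 1) ^ n) (conv_power augmented n F))"
  unfolding antipode_def
  by (rule sum.mono_neutral_left) (auto simp: conv_power_augmented_eq_0)

lemma basis_vec_eq: "basis_vec F = conv_unit F + augmented F"
  by (simp add: conv_unit_def augmented_def)

text \<open>On a forest of weight \<open>N\<close> the factors of its coproduct have weight at most \<open>N\<close>, hence the antipode
  may be truncated at \<open>N\<close> throughout, and the two convolution products telescope. The second one needs
  that \<open>J\<close> commutes with its convolution powers, which is where coassociativity enters.\<close>

lemma conv_antipode:
  "conv antipode basis_vec F = conv_unit F" "conv basis_vec antipode F = conv_unit F"
proof -
  let ?N = "weight F"
  let ?t = "\<lambda>n. scale ((- 1) ^ n) (conv_power augmented n F)"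
  have telescope: "(\<Sum>n\<le>?N. ?t n - ?t (Suc n)) = conv_unit F"
    by (subst sum_telescope) (simp add: conv_power_augmented_eq_0 del: conv_power.simps(2) power_Suc)
  have "conv antipode basis_vec F = lin_ext (\<lambda>p. \<Sum>n\<le>?N. scale ((- 1) ^ n)
      (conv_power augmented n (fst p) * basis_vec (snd p))) (cop F)"
    unfolding conv_def
  proof (rule lin_ext_cong, clarsimp)
    fix f g assume "(f, g) \<in> Poly_Mapping.keys (cop F)"
    then have "weight f \<le> ?N" using weight_keys_cop by fastforce
    then show "antipode f * basis_vec g =
        (\<Sum>n\<le>?N. scale ((- 1) ^ n) (conv_power augmented n f * basis_vec g))"
      by (simp add: antipode_eq[of f ?N] sum_distrib_right scale_mult_left)
  qed
  also have "\<dots> = (\<Sum>n\<le>?N. scale ((- 1) ^ n) (conv (conv_power augmented n) basis_vec F))"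
    by (simp add: lin_ext_sum_fun lin_ext_scale_fun conv_def case_prod_unfold)
  also have "\<dots> = (\<Sum>n\<le>?N. ?t n - ?t (Suc n))"
  proof (rule sum.cong[OF refl])
    fix n
    have "conv (conv_power augmented n) basis_vec F =
        conv (conv_power augmented n) conv_unit F + conv (conv_power augmented n) augmented F"
      unfolding conv_def lin_ext_add_fun[symmetric] basis_vec_eq
      by (simp add: case_prod_unfold distrib_left)
    then show "scale ((- 1) ^ n) (conv (conv_power augmented n) basis_vec F) = ?t n - ?t (Suc n)"
      by (simp add: conv_unit_right free.scale_right_distrib)
  qed
  finally show "conv antipode basis_vec F = conv_unit F" by (simp only: telescope)
  have "conv basis_vec antipode F = lin_ext (\<lambda>p. \<Sum>n\<le>?N. scale ((- 1) ^ n)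
      (basis_vec (fst p) * conv_power augmented n (snd p))) (cop F)"
    unfolding conv_def
  proof (rule lin_ext_cong, clarsimp)
    fix f g assume "(f, g) \<in> Poly_Mapping.keys (cop F)"
    then have "weight g \<le> ?N" using weight_keys_cop by fastforce
    then show "basis_vec f * antipode g =
        (\<Sum>n\<le>?N. scale ((- 1) ^ n) (basis_vec f * conv_power augmented n g))"
      by (simp add: antipode_eq[of g ?N] sum_distrib_left scale_mult_right)
  qed
  also have "\<dots> = (\<Sum>n\<le>?N. scale ((- 1) ^ n) (conv basis_vec (conv_power augmented n) F))"
    by (simp add: lin_ext_sum_fun lin_ext_scale_fun conv_def case_prod_unfold)
  also have "\<dots> = (\<Sum>n\<le>?N. ?t n - ?t (Suc n))"
  proof (rule sum.cong[OF refl])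
    fix n
    have "conv basis_vec (conv_power augmented n) F =
        conv conv_unit (conv_power augmented n) F + conv augmented (conv_power augmented n) F"
      unfolding conv_def lin_ext_add_fun[symmetric] basis_vec_eq
      by (simp add: case_prod_unfold distrib_right)
    then show "scale ((- 1) ^ n) (conv basis_vec (conv_power augmented n) F) = ?t n - ?t (Suc n)"
      by (simp add: conv_unit_left conv_power_commute free.scale_right_distrib)
  qed
  finally show "conv basis_vec antipode F = conv_unit F" by (simp only: telescope)
qed

lemma lin_ext_conv: "lin_ext (conv U V) x = lin_ext (\<lambda>(f, g). U f * V g) (coproduct x)"
  unfolding lin_ext_lin_ext conv_def[symmetric] ..

lemma is_antipode_antipode: "is_antipode coproduct counit (lin_ext antipode)"
proof -
  have id: "id = lin_ext basis_vec"
    by (simp add: fun_eq_iff)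
  show ?thesis
    unfolding is_antipode_def id mult_map_tensor_map lin_ext_conv[symmetric]
    by (simp add: linear_lin_ext conv_antipode lin_ext_conv_unit cong: lin_ext_cong)
qed

lemma lin_ext_conv_closed:
  assumes B: "unital_subalgebra B"
    and \<Delta>: "coproduct x \<in> free.span {tensor y z |y z. y \<in> B \<and> z \<in> B}"
    and U: "\<And>y. y \<in> B \<Longrightarrow> lin_ext U y \<in> B" and V: "\<And>y. y \<in> B \<Longrightarrow> lin_ext V y \<in> B"
  shows "lin_ext (conv U V) x \<in> B"
  unfolding lin_ext_conv using \<Delta>
proof (induction rule: free.span_induct)
  show "free.subspace {t. lin_ext (\<lambda>(f, g). U f * V g) t \<in> B}"
    using B unfolding unital_subalgebra_def free.subspace_def by (simp add: lin_ext_add lin_ext_scale)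
next
  fix t assume "t \<in> {tensor y z |y z. y \<in> B \<and> z \<in> B}"
  then obtain y z where "t = tensor y z" "y \<in> B" "z \<in> B" by auto
  then have "lin_ext (\<lambda>(f, g). U f * V g) t = lin_ext U y * lin_ext V z"
    by (simp add: lin_ext_tensor flip: lin_ext_times_left lin_ext_times_right)
  with U V B \<open>y \<in> B\<close> \<open>z \<in> B\<close> show "lin_ext (\<lambda>(f, g). U f * V g) t \<in> B"
    by (simp add: unital_subalgebra_def)
qed

text \<open>A subalgebra stable under the coproduct is automatically stable under the antipode: it is stable under
  \<open>J\<close>, hence under all convolution powers of \<open>J\<close>.\<close>

lemma hopf_subalgebraI:
  assumes B: "unital_subalgebra B"
    and \<Delta>: "\<And>x. x \<in> B \<Longrightarrow> coproduct x \<in> free.span {tensor y z |y z. y \<in> B \<and> z \<in> B}"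
  shows "hopf_subalgebra coproduct counit B"
proof -
  have sub: "free.subspace B" "1 \<in> B" using B by (auto simp: unital_subalgebra_def)
  have unit: "lin_ext conv_unit x \<in> B" for x
    using sub by (simp add: lin_ext_conv_unit free.subspace_scale)
  have aug: "lin_ext augmented x \<in> B" if "x \<in> B" for x
  proof -
    have "x = lin_ext conv_unit x + lin_ext augmented x"
      using lin_ext_add_fun[of conv_unit augmented x] by (simp flip: basis_vec_eq)
    then have "lin_ext augmented x = x - lin_ext conv_unit x"
      by (simp add: algebra_simps)
    then show ?thesis using sub that unit by (simp add: free.subspace_diff)
  qed
  have power: "lin_ext (conv_power augmented n) x \<in> B" if "x \<in> B" for n x
    using that
    by (induction n arbitrary: x) (auto intro: unit aug lin_ext_conv_closed[OF B \<Delta>])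
  have "lin_ext antipode x \<in> B" if "x \<in> B" for x
  proof -
    obtain N where N: "\<And>F. F \<in> Poly_Mapping.keys x \<Longrightarrow> weight F \<le> N"
      using finite_nat_set_iff_bounded_le[of "weight ` Poly_Mapping.keys x"] by auto
    have "lin_ext antipode x =
        lin_ext (\<lambda>F. \<Sum>n\<le>N. scale ((- 1) ^ n) (conv_power augmented n F)) x"
      by (rule lin_ext_cong) (simp add: antipode_eq N)
    also have "\<dots> = (\<Sum>n\<le>N. scale ((- 1) ^ n) (lin_ext (conv_power augmented n) x))"
      by (simp add: lin_ext_sum_fun lin_ext_scale_fun)
    also have "\<dots> \<in> B"
      using sub that by (intro free.subspace_sum free.subspace_scale power)
    finally show ?thesis .
  qed
  then show ?thesis
    unfolding hopf_subalgebra_def using B \<Delta> is_antipode_antipode by blast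
qed

end

section \<open>Linear maps applied coefficientwise\<close>

text \<open>For \<open>u\<close> linear this is the continuous extension of \<open>u\<close> to power series in the weight variable.\<close>

definition map_coeffs :: "('a \<Rightarrow> 'b) \<Rightarrow> 'a fps \<Rightarrow> 'b fps" where
  "map_coeffs u f = Abs_fps (\<lambda>n. u (fps_nth f n))"

lemma map_coeffs_nth [simp]: "fps_nth (map_coeffs u f) n = u (fps_nth f n)"
  by (simp add: map_coeffs_def)

lemma map_coeffs_mult:
  assumes "\<And>f g. \<phi> (f + g) = \<phi> f * \<phi> g"
  shows "map_coeffs (lin_ext \<phi>) (A * B) = map_coeffs (lin_ext \<phi>) A * map_coeffs (lin_ext \<phi>) B"
  by (rule fps_ext) (simp add: fps_mult_nth lin_ext_sum lin_ext_mult[OF assms])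

lemma map_coeffs_derivation:
  assumes "\<And>f g. \<chi> (f + g) = \<chi> f * \<phi> g + \<phi> f * \<chi> g"
  shows "map_coeffs (lin_ext \<chi>) (A * B) =
    map_coeffs (lin_ext \<chi>) A * map_coeffs (lin_ext \<phi>) B + map_coeffs (lin_ext \<phi>) A * map_coeffs (lin_ext \<chi>) B"
  by (rule fps_ext) (simp add: fps_mult_nth lin_ext_sum lin_ext_derivation[OF assms] sum.distrib)

lemma map_coeffs_one: "\<phi> 0 = 1 \<Longrightarrow> map_coeffs (lin_ext \<phi>) 1 = 1"
  by (rule fps_ext) (simp flip: single_one)

lemma map_coeffs_lin_ext_one: "map_coeffs (lin_ext \<phi>) 1 = fps_const (\<phi> 0)"
  by (rule fps_ext) (simp flip: single_one)

lemma map_coeffs_power: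
  assumes "\<And>f g. \<phi> (f + g) = \<phi> f * \<phi> g" "\<phi> 0 = 1"
  shows "map_coeffs (lin_ext \<phi>) (A ^ n) = map_coeffs (lin_ext \<phi>) A ^ n"
  by (induction n) (simp_all add: map_coeffs_one map_coeffs_mult assms)

lemma map_coeffs_add: "map_coeffs (lin_ext \<phi>) (A + B) = map_coeffs (lin_ext \<phi>) A + map_coeffs (lin_ext \<phi>) B"
  by (rule fps_ext) (simp add: lin_ext_add)

lemma map_coeffs_diff: "map_coeffs (lin_ext \<phi>) (A - B) = map_coeffs (lin_ext \<phi>) A - map_coeffs (lin_ext \<phi>) B"
  using map_coeffs_add[of \<phi> "A - B" B] by (simp add: algebra_simps)

lemma map_coeffs_scalar: "map_coeffs (lin_ext \<phi>) (scalar_fps c * A) = scalar_fps c * map_coeffs (lin_ext \<phi>) A"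
  by (rule fps_ext) (simp add: lin_ext_scale flip: scale_eq_const_mult)

lemma map_coeffs_eval:
  assumes "\<And>f g. \<phi> (f + g) = \<phi> f * \<phi> g" "\<phi> 0 = 1"
  shows "map_coeffs (lin_ext \<phi>) (fps_eval X P) = fps_eval (map_coeffs (lin_ext \<phi>) X) P"
  by (rule fps_ext)
    (simp add: fps_eval_nth_self lin_ext_sum lin_ext_scale flip: map_coeffs_power[OF assms])

section \<open>Subalgebras\<close>

lemma fps_coeffs_mult_closed:
  assumes "unital_subalgebra B" "\<And>n. fps_nth f n \<in> B" "\<And>n. fps_nth g n \<in> B"
  shows "fps_nth (f * g) n \<in> B"
  using assms unfolding fps_mult_nth unital_subalgebra_def by (auto intro!: free.subspace_sum)

lemma fps_coeffs_power_closed: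
  assumes "unital_subalgebra B" "\<And>n. fps_nth f n \<in> B"
  shows "fps_nth (f ^ k) n \<in> B"
proof (induction k arbitrary: n)
  case 0
  show ?case using assms(1) by (simp add: unital_subalgebra_def free.subspace_0)
next
  case (Suc k)
  then show ?case by (simp add: fps_coeffs_mult_closed assms)
qed

lemma fps_coeffs_eval_closed:
  assumes B: "unital_subalgebra B" and "\<And>n. fps_nth X n \<in> B"
  shows "fps_nth (fps_eval X P) n \<in> B"
proof -
  have "free.subspace B" using B by (simp add: unital_subalgebra_def)
  then show ?thesis
    unfolding fps_eval_nth_self
    by (intro free.subspace_sum free.subspace_scale fps_coeffs_power_closed[OF B] assms(2))
qed

lemma unital_subalgebra_span_tensor:
  assumes B: "unital_subalgebra B"
  shows "unital_subalgebra (free.span {tensor y z |y z. y \<in> B \<and> z \<in> B})" (is "unital_subalgebra (free.span ?T)")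
proof -
  have mult: "u * v \<in> free.span ?T" if u: "u \<in> free.span ?T" and v: "v \<in> free.span ?T" for u v
    using u
  proof (induction rule: free.span_induct)
    show "free.subspace {u. u * v \<in> free.span ?T}"
      unfolding free.subspace_def
      by (simp add: distrib_right scale_mult_left free.span_zero free.span_add free.span_scale)
  next
    fix u assume u: "u \<in> ?T"
    show "u * v \<in> free.span ?T"
      using v
    proof (induction rule: free.span_induct)
      show "free.subspace {v. u * v \<in> free.span ?T}"
        unfolding free.subspace_def
        by (simp add: distrib_left scale_mult_right free.span_zero free.span_add free.span_scale)
    next
      fix v assume "v \<in> ?T"
      with u obtain y z y' z' where uv: "u = tensor y z" "v = tensor y' z'"
          and "y \<in> B" "z \<in> B" "y' \<in> B" "z' \<in> B"
        by blast
      with B have "y * y' \<in> B" "z * z' \<in> B"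
        by (auto simp: unital_subalgebra_def)
      then have "u * v \<in> ?T"
        unfolding uv tensor_mult by blast
      then show "u * v \<in> free.span ?T" by (rule free.span_base)
    qed
  qed
  have "1 \<in> ?T"
    using B tensor_one_one by (force simp: unital_subalgebra_def)
  then show ?thesis
    unfolding unital_subalgebra_def using mult by (simp add: free.span_base)
qed

lemma unital_subalgebra_hull: "unital_subalgebra (unital_subalgebra hull S)"
proof (rule hull_in)
  fix T :: "('a \<Rightarrow>\<^sub>0 'b) set set" assume "Ball T unital_subalgebra"
  then show "unital_subalgebra (\<Inter> T)"
    unfolding unital_subalgebra_def by (auto intro!: free.subspace_Inter)
qed

section \<open>Twisted substitution in the tensor square\<close>

abbreviation tensor_left :: "('f \<Rightarrow>\<^sub>0 'k) \<Rightarrow> (('f \<times> 'f::monoid_add) \<Rightarrow>\<^sub>0 'k::field_char_0)" where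
  "tensor_left \<equiv> lin_ext (\<lambda>f. basis_vec (f, 0))"

abbreviation tensor_right :: "('f \<Rightarrow>\<^sub>0 'k) \<Rightarrow> (('f::monoid_add \<times> 'f) \<Rightarrow>\<^sub>0 'k::field_char_0)" where
  "tensor_right \<equiv> lin_ext (\<lambda>g. basis_vec (0, g))"

lemma tensor_left_eq: "tensor_left x = tensor x (1 :: 'f::monoid_add \<Rightarrow>\<^sub>0 'k::field_char_0)"
  using tensor_basis_vec_right[of x "0::'f"] by simp

lemma tensor_right_eq: "tensor_right y = tensor (1 :: 'f::monoid_add \<Rightarrow>\<^sub>0 'k::field_char_0) y"
  using tensor_basis_vec_left[of "0::'f" y] by simp

lemma tensor_eq_mult:
  "tensor x y = tensor_left x * tensor_right y" "tensor x y = tensor_right y * tensor_left x"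
  by (simp_all add: tensor_left_eq tensor_right_eq tensor_mult)

text \<open>The substitution \<open>h \<mapsto> s h\<close>, carried out in the right tensor factor with \<open>s\<close> a series over the
  left one: it sends \<open>\<Sum>\<^sub>n v\<^sub>n h\<^sup>n\<close> to \<open>\<Sum>\<^sub>n s\<^sup>n \<otimes> v\<^sub>n h\<^sup>n\<close>. Since the two tensor factors
  commute with each other and the powers of \<open>s\<close> commute among themselves, it is a ring homomorphism.\<close>

definition twist :: "('f::monoid_add \<Rightarrow>\<^sub>0 'k) fps \<Rightarrow> ('f \<Rightarrow>\<^sub>0 'k) fps \<Rightarrow> (('f \<times> 'f) \<Rightarrow>\<^sub>0 'k::field_char_0) fps" where
  "twist s v = family_sum (\<lambda>n. fps_X ^ n *
     (map_coeffs tensor_left s ^ n * fps_const (tensor_right (fps_nth v n))))"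

lemma locally_finite_twist: "locally_finite (\<lambda>n. fps_X ^ n * u n)"
  by (simp add: locally_finite_def fps_X_power_mult_nth)

lemma map_coeffs_tensor_left_hom:
  "map_coeffs tensor_left (A * B) = map_coeffs tensor_left A * map_coeffs tensor_left B"
  "map_coeffs tensor_left (A ^ n) = map_coeffs tensor_left A ^ n"
  "map_coeffs tensor_left 1 = 1"
  by (subst map_coeffs_mult map_coeffs_power map_coeffs_one; simp add: mult_single flip: zero_prod_def)+

lemma tensor_right_commute:
  "fps_const (tensor_right y) * map_coeffs tensor_left A = map_coeffs tensor_left A * fps_const (tensor_right y)"
  by (rule fps_ext) (simp flip: tensor_eq_mult)

lemma tensor_right_hom: "tensor_right (x * y) = tensor_right x * tensor_right y"
  by (rule lin_ext_mult) (simp add: mult_single)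

lemma twist_mult: "twist s (v * w) = twist s v * twist s w"
proof -
  let ?\<sigma> = "map_coeffs tensor_left s"
  let ?c = "\<lambda>v n. fps_const (tensor_right (fps_nth v n))"
  have "(\<Sum>i\<le>n. fps_X ^ i * (?\<sigma> ^ i * ?c v i) * (fps_X ^ (n - i) * (?\<sigma> ^ (n - i) * ?c w (n - i)))) =
        fps_X ^ n * (?\<sigma> ^ n * ?c (v * w) n)" for n
  proof -
    have "fps_X ^ i * (?\<sigma> ^ i * ?c v i) * (fps_X ^ (n - i) * (?\<sigma> ^ (n - i) * ?c w (n - i))) =
        fps_X ^ n * (?\<sigma> ^ n * fps_const (tensor_right (fps_nth v i * fps_nth w (n - i))))"
      if "i \<le> n" for i
    proof -
      have "fps_X ^ i * (?\<sigma> ^ i * ?c v i) * (fps_X ^ (n - i) * (?\<sigma> ^ (n - i) * ?c w (n - i))) =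
            fps_X ^ i * (?\<sigma> ^ i * ?c v i * fps_X ^ (n - i)) * (?\<sigma> ^ (n - i) * ?c w (n - i))"
        by (simp only: mult.assoc)
      also have "\<dots> = (fps_X ^ i * fps_X ^ (n - i)) * (?\<sigma> ^ i * (?c v i * ?\<sigma> ^ (n - i)) * ?c w (n - i))"
        unfolding fps_mult_fps_X_power_commute[of "n - i" "?\<sigma> ^ i * ?c v i", symmetric]
        by (simp only: mult.assoc)
      also have "?c v i * ?\<sigma> ^ (n - i) = ?\<sigma> ^ (n - i) * ?c v i"
        by (simp only: tensor_right_commute map_coeffs_tensor_left_hom(2)[symmetric])
      also have "(fps_X ^ i * fps_X ^ (n - i)) * (?\<sigma> ^ i * (?\<sigma> ^ (n - i) * ?c v i) * ?c w (n - i)) =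
          (fps_X ^ i * fps_X ^ (n - i)) * ((?\<sigma> ^ i * ?\<sigma> ^ (n - i)) * (?c v i * ?c w (n - i)))"
        by (simp only: mult.assoc)
      finally show ?thesis
        using that by (simp add: tensor_right_hom flip: power_add)
    qed
    moreover have "?c (v * w) n = (\<Sum>i\<le>n. fps_const (tensor_right (fps_nth v i * fps_nth w (n - i))))"
      by (rule fps_ext) (simp add: fps_mult_nth lin_ext_sum fps_sum_nth atLeast0AtMost)
    ultimately show ?thesis
      by (simp add: sum_distrib_left)
  qed
  then show ?thesis
    unfolding twist_def by (simp add: family_sum_mult locally_finite_twist)
qed

lemma twist_one: "twist s 1 = 1"
proof -
  have "twist s 1 = family_sum (\<lambda>n. if n = 0 then 1 else 0)"
    unfolding twist_def
    by (rule arg_cong[of _ _ family_sum], rule ext)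
      (simp flip: single_one zero_prod_def)
  then show ?thesis
    by (simp add: fps_eq_iff family_sum_def if_distrib[of "\<lambda>f. fps_nth f _"] cong: if_cong)
qed

lemma twist_power: "twist s (v ^ n) = twist s v ^ n"
  by (induction n) (simp_all add: twist_one twist_mult)

lemma twist_nth:
  "fps_nth (twist s v) N =
   (\<Sum>n\<le>N. fps_nth (map_coeffs tensor_left (s ^ n)) (N - n) * tensor_right (fps_nth v n))"
  unfolding twist_def family_sum_def fps_nth_Abs_fps
  by (intro sum.cong refl) (simp add: fps_X_power_mult_nth flip: map_coeffs_tensor_left_hom)

lemma twist_eval:
  assumes "fps_nth X 0 = 0"
  shows "twist s (fps_eval X P) = fps_eval (twist s X) P"
proof (rule fps_ext)
  fix N
  have "fps_nth (twist s (fps_eval X P)) N = (\<Sum>n\<le>N. \<Sum>k\<le>N. scale (fps_nth P k)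
      (fps_nth (map_coeffs tensor_left (s ^ n)) (N - n) * tensor_right (fps_nth (X ^ k) n)))"
    unfolding twist_nth
    by (intro sum.cong refl)
      (simp add: fps_eval_nth[OF assms] lin_ext_sum lin_ext_scale sum_distrib_left scale_mult_right del: map_coeffs_nth)
  also have "\<dots> = (\<Sum>k\<le>N. scale (fps_nth P k) (fps_nth (twist s (X ^ k)) N))"
    unfolding twist_nth free.scale_sum_right by (rule sum.swap)
  finally show "fps_nth (twist s (fps_eval X P)) N = fps_nth (fps_eval (twist s X) P) N"
    by (simp add: fps_eval_nth_self twist_power)
qed

lemma mult_twist_nth:
  "fps_nth (map_coeffs tensor_left f * twist s v) N =
   (\<Sum>n\<le>N. tensor (fps_nth (f * s ^ n) (N - n)) (fps_nth v n))"
proof -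
  have "map_coeffs tensor_left f * twist s v = family_sum (\<lambda>n. fps_X ^ n *
     (map_coeffs tensor_left (f * s ^ n) * fps_const (tensor_right (fps_nth v n))))"
    unfolding twist_def family_sum_mult_left[OF locally_finite_twist]
    by (rule arg_cong[of _ _ family_sum], rule ext)
      (simp only: map_coeffs_tensor_left_hom mult.assoc[symmetric]
        fps_mult_fps_X_power_commute[of _ "map_coeffs tensor_left f", symmetric])
  then show ?thesis
    by (simp add: family_sum_def fps_X_power_mult_nth flip: tensor_eq_mult)
qed

section \<open>The coproduct of the Dyson--Schwinger solution\<close>

context forest_bialgebra
begin

abbreviation dse :: "'k fps \<Rightarrow> ('f \<Rightarrow>\<^sub>0 'k) fps" where
  "dse P \<equiv> Abs_fps (dse_coeff Bplus P)"

lemma dse_nth: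
  assumes "fps_nth P 0 = 1"
  shows "fps_nth (dse P) 0 = 0" "fps_nth (dse P) (Suc n) = Bplus (fps_nth (fps_eval (dse P) P) n)"
  using dse_coeff_equation[OF linear_lin_ext assms] unfolding fps_eval_nth_self by blast+

text \<open>If \<open>P\<close> satisfies the differential equation, then
  \<open>\<Delta>(X) = X \<otimes> 1 + \<Sum>\<^sub>n (1 - \<gamma> X) s\<^sup>n \<otimes> a\<^sub>n h\<^sup>n\<close>  with  \<open>s = P(X) / (1 - \<gamma> X)\<close>.
  The right-hand side is \<open>Y = A + (1 - \<gamma> A) T\<close>, where \<open>A = X \<otimes> 1\<close> and \<open>T\<close> is the twist of \<open>X\<close> by \<open>s\<close>. By the
  functional equation \<open>P(Y) = P(A) P(T)\<close>, where \<open>P(A) = P(X) \<otimes> 1\<close> and \<open>P(T)\<close> is the twist of \<open>P(X)\<close>,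
  because twisting is a homomorphism. Applying \<open>id \<otimes> B\<^sup>+\<close> thus turns \<open>P(Y)\<close> into
  \<open>\<Sum>\<^sub>n P(X) s\<^sup>n \<otimes> a\<^bsub>n+1\<^esub> h\<^sup>n\<close>, and \<open>P(X) s\<^sup>n = (1 - \<gamma> X) s\<^bsup>n+1\<^esup>\<close>. So \<open>Y\<close> satisfies the same
  fixed point equation \<open>Y = X \<otimes> 1 + h (id \<otimes> B\<^sup>+)(P(Y))\<close> as \<open>\<Delta>(X)\<close>, and its solution is unique.\<close>

lemma coproduct_dse:
  assumes ode: "(1 - fps_const \<gamma> * fps_X) * fps_deriv P = fps_const \<alpha> * P" and P0: "fps_nth P 0 = 1"
  defines "X \<equiv> dse P"
  shows "fps_nth (map_coeffs coproduct X) N = tensor (fps_nth X N) 1 +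
    (\<Sum>n\<le>N. tensor (fps_nth ((1 - scalar_fps \<gamma> * X) *
        fps_eval X (P * inverse (1 - fps_const \<gamma> * fps_X)) ^ n) (N - n)) (fps_nth X n))"
proof -
  let ?L = "1 - fps_const \<gamma> * fps_X :: 'k fps"
  define S where "S = P * inverse ?L"
  have LS: "?L * S = P"
    using inverse_mult_eq_1[of ?L] by (simp add: S_def mult.left_commute mult.commute)
  have X0: "fps_nth X 0 = 0" and XS: "fps_nth X (Suc n) = Bplus (fps_nth (fps_eval X P) n)" for n
    unfolding X_def by (simp_all only: dse_nth[OF P0])
  define l where "l = 1 - scalar_fps \<gamma> * X"
  define s where "s = fps_eval X S"
  have l_eq: "l = fps_eval X ?L"
    by (simp add: l_def fps_eval_diff fps_eval_one fps_eval_mult fps_eval_const fps_eval_X X0)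
  have ls: "l * s = fps_eval X P"
    unfolding l_eq s_def LS[symmetric] by (rule fps_eval_mult[OF X0, symmetric])
  define A where "A = map_coeffs tensor_left X"
  define T where "T = twist s X"
  define Y where "Y = A + map_coeffs tensor_left l * T"
  define Z where "Z = map_coeffs coproduct X"
  define B2 where "B2 = lin_ext (\<lambda>(f::'f, g). basis_vec (f, graft g) :: _ \<Rightarrow>\<^sub>0 'k)"
  have A0: "fps_nth A 0 = 0" and T0: "fps_nth T 0 = 0"
    by (simp_all add: A_def T_def twist_nth X0)
  have Y_nth: "fps_nth Y N = tensor_left (fps_nth X N) +
      (\<Sum>n\<le>N. tensor (fps_nth (l * s ^ n) (N - n)) (fps_nth X n))" for N
    by (simp add: Y_def A_def T_def mult_twist_nth)
  have commX: "X * s = s * X"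
    using fps_eval_mult[OF X0, of fps_X S] fps_eval_mult[OF X0, of S fps_X]
    by (simp add: s_def fps_eval_X[OF X0] mult.commute)
  have commA: "A * T = T * A"
  proof -
    let ?u = "\<lambda>n. fps_X ^ n * (map_coeffs tensor_left s ^ n * fps_const (tensor_right (fps_nth X n)))"
    have "A * ?u n = ?u n * A" for n
    proof -
      have "A * map_coeffs tensor_left s = map_coeffs tensor_left s * A"
        unfolding A_def by (simp only: map_coeffs_tensor_left_hom(1)[symmetric] commX)
      then have s: "A * map_coeffs tensor_left s ^ n = map_coeffs tensor_left s ^ n * A"
        by (metis power_commuting_commutes)
      have "A * ?u n = fps_X ^ n * (A * map_coeffs tensor_left s ^ n * fps_const (tensor_right (fps_nth X n)))"
        by (simp only: mult.assoc[symmetric] fps_mult_fps_X_power_commute[of n A])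
      also have "\<dots> = fps_X ^ n * (map_coeffs tensor_left s ^ n * (A * fps_const (tensor_right (fps_nth X n))))"
        by (simp only: s mult.assoc)
      finally show ?thesis
        unfolding A_def tensor_right_commute[symmetric] by (simp only: mult.assoc)
    qed
    then show ?thesis
      unfolding T_def twist_def
      by (simp only: family_sum_mult_left family_sum_mult_right locally_finite_twist)
  qed
  have Y_eq: "Y = A + (1 - scalar_fps \<gamma> * A) * T"
    by (simp only: Y_def l_def A_def map_coeffs_diff map_coeffs_scalar map_coeffs_tensor_left_hom(3))
  have Y_rec: "fps_nth Y (Suc n) = tensor (fps_nth X (Suc n)) 1 + B2 (fps_nth (fps_eval Y P) n)" for n
  proof -
    have B2: "B2 (tensor x y) = tensor x (Bplus y)" for x y
      unfolding B2_def lin_ext_tensor prod.case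
      by (simp add: tensor_def lin_ext_lin_ext)
    have "fps_eval Y P = map_coeffs tensor_left (fps_eval X P) * twist s (fps_eval X P)"
      unfolding Y_eq fps_eval_ode[OF ode P0 commA A0 T0] unfolding A_def T_def
      by (simp add: twist_eval X0 map_coeffs_eval mult_single flip: zero_prod_def)
    then have "B2 (fps_nth (fps_eval Y P) n) =
        (\<Sum>m\<le>n. tensor (fps_nth (l * s * s ^ m) (n - m)) (fps_nth X (Suc m)))"
      by (simp add: mult_twist_nth XS ls B2_def lin_ext_sum flip: B2[unfolded B2_def])
    then show ?thesis
      unfolding Y_nth sum.atMost_Suc_shift by (simp add: X0 tensor_left_eq mult.assoc)
  qed
  have Z_rec: "fps_nth Z (Suc n) = tensor (fps_nth X (Suc n)) 1 + B2 (fps_nth (fps_eval Z P) n)" for n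
  proof -
    have "fps_eval Z P = map_coeffs coproduct (fps_eval X P)"
      unfolding Z_def by (rule map_coeffs_eval[symmetric]) (simp_all add: cop_add cop_zero)
    then show ?thesis
      by (simp add: Z_def XS coproduct_Bplus B2_def)
  qed
  \<comment> \<open>Both recursions express a coefficient through the lower ones.\<close>
  have "fps_nth Z N = fps_nth Y N" for N
  proof (induction N rule: less_induct)
    case (less N)
    show ?case
    proof (cases N)
      case 0
      then show ?thesis by (simp add: Z_def Y_nth X0)
    next
      case (Suc n)
      have "fps_nth (fps_eval Z P) n = fps_nth (fps_eval Y P) n"
        by (rule fps_eval_nth_cong) (use less Suc in auto)
      then show ?thesis by (simp add: Suc Z_rec Y_rec)
    qed
  qed
  then show ?thesis
    by (simp add: Y_nth Z_def l_def s_def S_def tensor_left_eq)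
qed

lemma unital_subalgebra_coproduct_vimage:
  "unital_subalgebra C \<Longrightarrow> unital_subalgebra {x. coproduct x \<in> C}"
  unfolding unital_subalgebra_def free.subspace_def
  by (simp add: lin_ext_add lin_ext_scale coproduct_one coproduct_mult)

text \<open>All left factors in the formula for \<open>\<Delta>(X)\<close> are coefficients of series in \<open>X\<close>, so they lie in the
  subalgebra generated by the \<open>a\<^sub>n\<close>. The coproduct being multiplicative, it suffices to know this on the
  generators.\<close>

lemma hopf_subalgebra_dse_if_ode:
  assumes ode: "(1 - fps_const \<gamma> * fps_X) * fps_deriv P = fps_const \<alpha> * P" and P0: "fps_nth P 0 = 1"
  shows "hopf_subalgebra coproduct counit (unital_subalgebra hull {dse_coeff Bplus P n |n. 1 \<le> n})"
    (is "hopf_subalgebra _ _ ?B")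
proof (rule hopf_subalgebraI)
  show B: "unital_subalgebra ?B" by (rule unital_subalgebra_hull)
  then have sub: "free.subspace ?B" and one: "1 \<in> ?B" and mult: "\<And>x y. x \<in> ?B \<Longrightarrow> y \<in> ?B \<Longrightarrow> x * y \<in> ?B"
    by (auto simp: unital_subalgebra_def)
  have XB: "fps_nth (dse P) n \<in> ?B" for n
  proof (cases n)
    case 0
    then show ?thesis using sub by (simp add: free.subspace_0)
  next
    case (Suc m)
    then show ?thesis by (auto intro: hull_inc)
  qed
  let ?T = "{tensor y z |y z. y \<in> ?B \<and> z \<in> ?B}"
  have in_T: "tensor y z \<in> free.span ?T" if "y \<in> ?B" "z \<in> ?B" for y z
    using that by (auto intro!: free.span_base)
  have gen: "coproduct (dse_coeff Bplus P n) \<in> free.span ?T" for n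
  proof -
    have "fps_nth (scalar_fps \<gamma> * dse P) m \<in> ?B" for m
      unfolding scalar_fps_nth by (rule free.subspace_scale[OF sub XB])
    then have "fps_nth (1 - scalar_fps \<gamma> * dse P) m \<in> ?B" for m
      using one sub by (auto intro!: free.subspace_diff free.subspace_neg simp: free.subspace_0 simp del: fps_mult_left_const_nth)
    then have "fps_nth (map_coeffs coproduct (dse P)) n \<in> free.span ?T"
      unfolding coproduct_dse[OF ode P0]
      by (intro free.span_add free.span_sum in_T fps_coeffs_mult_closed[OF B] fps_coeffs_power_closed[OF B]
          fps_coeffs_eval_closed[OF B] XB one)
    then show ?thesis by simp
  qed
  have "unital_subalgebra {x. coproduct x \<in> free.span ?T}"
    by (intro unital_subalgebra_coproduct_vimage unital_subalgebra_span_tensor B)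
  then have "?B \<subseteq> {x. coproduct x \<in> free.span ?T}"
    using gen by (intro hull_minimal) blast+
  then show "x \<in> ?B \<Longrightarrow> coproduct x \<in> free.span ?T" for x by blast
qed

end

section \<open>The derivation removing a leaf\<close>

context forest_bialgebra
begin

text \<open>The map \<open>Z \<otimes> id\<close>, where \<open>Z\<close> is the coefficient of the one-vertex tree. Composed with the coproduct
  it sends a forest to the sum of the forests obtained by deleting one leaf. As \<open>Z\<close> is a derivation
  along the counit, the composition is a derivation.\<close>

definition cut_leaf :: "(('f \<times> 'f) \<Rightarrow>\<^sub>0 'k) \<Rightarrow> ('f \<Rightarrow>\<^sub>0 'k)" where
  "cut_leaf = lin_ext (\<lambda>(f, g). if f = graft 0 then basis_vec g else 0)"

definition remove_leaf :: "'f \<Rightarrow> ('f \<Rightarrow>\<^sub>0 'k)" where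
  "remove_leaf F = cut_leaf (cop F)"

lemma add_eq_leaf_iff:
  "F + G = graft 0 \<longleftrightarrow> F = graft 0 \<and> G = 0 \<or> F = 0 \<and> G = graft 0"
proof
  assume eq: "F + G = graft 0"
  then have "weight F + weight G = 1"
    by (simp add: weight_graft flip: weight_add)
  then have "F = 0 \<or> G = 0"
    using weight_eq_0_iff[of F] weight_eq_0_iff[of G] by linarith
  with eq show "F = graft 0 \<and> G = 0 \<or> F = 0 \<and> G = graft 0" by auto
qed auto

lemma remove_leaf_add:
  "remove_leaf (F + G) = remove_leaf F * basis_vec G + basis_vec F * remove_leaf G"
proof -
  let ?e = "\<lambda>(f::'f, g::'f). if f = 0 then basis_vec g else (0 :: 'f \<Rightarrow>\<^sub>0 'k)"
  have "cut_leaf (x * y) = cut_leaf x * lin_ext ?e y + lin_ext ?e x * cut_leaf y" for x y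
    unfolding cut_leaf_def
  proof (rule lin_ext_derivation)
    fix p q :: "'f \<times> 'f"
    obtain f g f' g' where pq: "p = (f, g)" "q = (f', g')"
      by (cases p, cases q)
    show "(case p + q of (f, g) \<Rightarrow> if f = graft 0 then basis_vec g else 0) =
      (case p of (f, g) \<Rightarrow> if f = graft 0 then basis_vec g else 0) * ?e q +
      ?e p * (case q of (f, g) \<Rightarrow> if f = graft 0 then basis_vec g else (0 :: 'f \<Rightarrow>\<^sub>0 'k))"
      using graft_neq_zero[of 0] by (auto simp: pq add_eq_leaf_iff mult_single)
  qed
  then show ?thesis
    by (simp add: remove_leaf_def cop_add left_counit)
qed

lemma remove_leaf_zero: "remove_leaf 0 = 0"
proof -
  have "cut_leaf (basis_vec (0, 0)) = 0"
    unfolding cut_leaf_def lin_ext_single using graft_neq_zero[of 0] by auto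
  then show ?thesis
    by (simp add: remove_leaf_def cop_zero zero_prod_def flip: single_one)
qed

lemma remove_leaf_graft: "remove_leaf (graft F) = conv_unit F + Bplus (remove_leaf F)"
proof -
  have "cut_leaf (basis_vec (graft F, 0)) = conv_unit F"
    using graft_inject[of F 0] by (auto simp: cut_leaf_def conv_unit_def)
  moreover have "cut_leaf (lin_ext (\<lambda>(f, g). basis_vec (f, graft g)) (cop F)) = Bplus (remove_leaf F)"
    by (simp add: cut_leaf_def remove_leaf_def lin_ext_lin_ext case_prod_unfold if_distrib cong: if_cong)
  ultimately show ?thesis
    by (simp add: remove_leaf_def cop_graft) (simp add: cut_leaf_def lin_ext_add)
qed

lemma remove_leaf_Bplus:
  "lin_ext remove_leaf (Bplus x) = lin_ext conv_unit x + Bplus (lin_ext remove_leaf x)"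
  by (simp add: lin_ext_lin_ext remove_leaf_graft lin_ext_add_fun)

lemma remove_leaf_one: "lin_ext remove_leaf 1 = 0"
  by (simp add: remove_leaf_zero flip: single_one)

lemma weight_remove_leaf: "g \<in> Poly_Mapping.keys (remove_leaf F) \<Longrightarrow> Suc (weight g) = weight F"
proof -
  assume "g \<in> Poly_Mapping.keys (remove_leaf F)"
  then obtain p where p: "p \<in> Poly_Mapping.keys (cop F)"
      "g \<in> Poly_Mapping.keys (case p of (f, g) \<Rightarrow> if f = graft 0 then basis_vec g else (0 :: 'f \<Rightarrow>\<^sub>0 'k))"
    unfolding remove_leaf_def cut_leaf_def by (auto dest!: subsetD[OF keys_lin_ext])
  then have "p = (graft 0, g)"
    by (cases p) (auto split: if_splits)
  with p(1) weight_keys_cop show ?thesis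
    by (fastforce simp: weight_graft)
qed

subsection \<open>Homogeneity and projections\<close>

definition homogeneous :: "nat \<Rightarrow> ('f \<Rightarrow>\<^sub>0 'k) \<Rightarrow> bool" where
  "homogeneous n x \<longleftrightarrow> (\<forall>F\<in>Poly_Mapping.keys x. weight F = n)"

lemma homogeneous_mult: "homogeneous m x \<Longrightarrow> homogeneous n y \<Longrightarrow> homogeneous (m + n) (x * y)"
  unfolding homogeneous_def using keys_mult[of x y] by (fastforce simp: weight_add)

lemma homogeneous_Bplus: "homogeneous n x \<Longrightarrow> homogeneous (Suc n) (Bplus x)"
  unfolding homogeneous_def
  using keys_lin_ext[of "\<lambda>F. basis_vec (graft F) :: 'f \<Rightarrow>\<^sub>0 'k" x] by (fastforce simp: weight_graft)

lemma homogeneous_scale: "homogeneous n x \<Longrightarrow> homogeneous n (scale c x)"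
  by (auto simp: homogeneous_def in_keys_iff)

lemma homogeneous_sum: "(\<And>i. i \<in> A \<Longrightarrow> homogeneous n (x i)) \<Longrightarrow> homogeneous n (sum x A)"
  by (auto simp: homogeneous_def in_keys_iff lookup_sum elim!: sum.not_neutral_contains_not_neutral)

lemma homogeneous_dse_coeff: "homogeneous n (dse_coeff Bplus P n)"
proof (induction n rule: less_induct)
  case (less n)
  have prod: "homogeneous (sum_list \<alpha>) (prod_list (map (dse_coeff Bplus P) \<alpha>))"
    if "\<And>i. i \<in> set \<alpha> \<Longrightarrow> i < n" for \<alpha>
    using that
  proof (induction \<alpha>)
    case Nil
    show ?case by (simp add: homogeneous_def flip: single_one)
  next
    case (Cons i \<alpha>)
    then show ?case by (simp add: homogeneous_mult less.IH)
  qed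
  consider "n = 0" | "n = Suc 0" | m where "n = Suc (Suc m)"
    by (metis not0_implies_Suc)
  then show ?case
  proof cases
    case 1
    then show ?thesis by (simp add: homogeneous_def)
  next
    case 2
    have "homogeneous 0 1" by (simp add: homogeneous_def flip: single_one)
    then show ?thesis using homogeneous_Bplus 2 by fastforce
  next
    case (3 m)
    have "homogeneous (Suc m) (prod_list (map (dse_coeff Bplus P) \<alpha>))"
      if "\<alpha> \<in> compositions (Suc m) k" for \<alpha> k
    proof -
      have "i < n" if "i \<in> set \<alpha>" for i
        using \<open>\<alpha> \<in> _\<close> that member_le_sum_list[of i \<alpha>] 3 by (auto simp: compositions_def)
      then show ?thesis
        using prod[of \<alpha>] that by (simp add: compositions_def)
    qed
    then show ?thesis
      unfolding 3 dse_coeff.simps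
      by (intro homogeneous_sum homogeneous_scale homogeneous_Bplus)
  qed
qed

lemma Bplus_inject: "Bplus x = Bplus y \<Longrightarrow> x = y"
proof (rule poly_mapping_eqI)
  fix F
  have "Poly_Mapping.lookup (Bplus x) (graft F) = Poly_Mapping.lookup x F" for x
    by (induction x rule: basis_induct)
      (auto simp: lin_ext_add lin_ext_scale lookup_add lookup_single when_def dest: graft_inject)
  then show "Bplus x = Bplus y \<Longrightarrow> Poly_Mapping.lookup x F = Poly_Mapping.lookup y F" by metis
qed

text \<open>The projection on the span of the trees (forests of length one) whose weight satisfies \<open>Q\<close>. As a
  product of two elements without constant term has no part of length one, it is a derivation along the
  counit.\<close>

definition tree_part :: "(nat \<Rightarrow> bool) \<Rightarrow> 'f \<Rightarrow> ('f \<Rightarrow>\<^sub>0 'k)" where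
  "tree_part Q F = (if len F = 1 \<and> Q (weight F) then basis_vec F else 0)"

lemma tree_part_add:
  "tree_part Q (F + G) = tree_part Q F * conv_unit G + conv_unit F * tree_part Q G"
proof -
  have "len F + len G = 1 \<longleftrightarrow> len F = 1 \<and> G = 0 \<or> F = 0 \<and> len G = 1"
    using len_eq_0_iff[of F] len_eq_0_iff[of G] by linarith
  then show ?thesis
    by (auto simp: tree_part_def conv_unit_def len_add)
qed

lemma conv_unit_add: "conv_unit (F + G) = conv_unit F * conv_unit G"
  by (simp add: conv_unit_def)

lemma lin_ext_conv_unit_Bplus: "lin_ext conv_unit (Bplus x) = 0"
  by (simp add: lin_ext_lin_ext conv_unit_def)

lemma tree_part_Bplus:
  assumes "homogeneous n (Bplus x)"
  shows "lin_ext (tree_part Q) (Bplus x) = (if Q n then Bplus x else 0)"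
proof -
  have "len F = 1" if "F \<in> Poly_Mapping.keys (Bplus x)" for F
    using that keys_lin_ext[of "\<lambda>F. basis_vec (graft F) :: 'f \<Rightarrow>\<^sub>0 'k" x] len_graft by fastforce
  then have "lin_ext (tree_part Q) (Bplus x) = lin_ext (\<lambda>F. if Q n then basis_vec F else 0) (Bplus x)"
    using assms by (intro lin_ext_cong) (auto simp: tree_part_def homogeneous_def)
  then show ?thesis by simp
qed

lemma dse_coeff_Suc:
  assumes "fps_nth P 0 = 1"
  shows "dse_coeff Bplus P (Suc n) = Bplus (fps_nth (fps_eval (dse P) P) n)"
  using dse_nth(2)[OF assms, of n] by simp

lemma conv_unit_dse:
  assumes "fps_nth P 0 = 1"
  shows "map_coeffs (lin_ext conv_unit) (dse P) = 0"
proof (rule fps_ext)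
  fix n show "fps_nth (map_coeffs (lin_ext conv_unit) (dse P)) n = fps_nth 0 n"
    by (cases n) (simp_all add: dse_coeff_Suc[OF assms] lin_ext_conv_unit_Bplus)
qed

lemma conv_unit_eval_dse:
  assumes "fps_nth P 0 = 1"
  shows "lin_ext conv_unit (fps_nth (fps_eval (dse P) P) (Suc n)) = 0"
proof -
  have "lin_ext conv_unit (fps_nth (fps_eval (dse P) P) (Suc n)) =
      fps_nth (map_coeffs (lin_ext conv_unit) (fps_eval (dse P) P)) (Suc n)"
    by simp
  also have "\<dots> = fps_nth (fps_eval 0 P) (Suc n)"
    by (subst map_coeffs_eval) (simp_all add: conv_unit_add conv_unit_dse[OF assms], simp add: conv_unit_def)
  also have "\<dots> = 0"
    unfolding fps_eval_nth_self by (intro sum.neutral ballI) (simp add: power_0_left)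
  finally show ?thesis .
qed

lemma tree_part_dse_coeff:
  assumes "fps_nth P 0 = 1"
  shows "lin_ext (tree_part Q) (dse_coeff Bplus P n) = (if Q n then dse_coeff Bplus P n else 0)"
proof (cases n)
  case (Suc m)
  then show ?thesis
    using tree_part_Bplus[of n _ Q] homogeneous_dse_coeff[of n P] dse_coeff_Suc[OF assms, of m] by metis
qed simp

text \<open>A derivation along the counit annihilates products of elements of the augmentation ideal, so on the
  subalgebra generated by the \<open>a\<^sub>n\<close> the projection on trees of weight \<open>n\<close> only sees the generator \<open>a\<^sub>n\<close>
  itself.\<close>

lemma tree_part_dse_subalgebra:
  assumes P0: "fps_nth P 0 = 1"
    and "x \<in> unital_subalgebra hull {dse_coeff Bplus P n |n. 1 \<le> n}"
  shows "\<exists>c. lin_ext (tree_part (\<lambda>m. m = n)) x = scale c (dse_coeff Bplus P n)"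
proof -
  let ?a = "dse_coeff Bplus P n" and ?p = "lin_ext (tree_part (\<lambda>m. m = n))"
  let ?S = "{x. ?p x \<in> range (\<lambda>c. scale c ?a)}"
  have "unital_subalgebra ?S"
    unfolding unital_subalgebra_def free.subspace_def
  proof (safe)
    show "?p 0 \<in> range (\<lambda>c. scale c ?a)"
      by (auto intro!: image_eqI[of _ _ 0])
    show "?p 1 \<in> range (\<lambda>c. scale c ?a)"
      by (auto intro!: image_eqI[of _ _ 0] simp: tree_part_def simp flip: single_one)
  next
    fix x y c d assume "?p x = scale c ?a" "?p y = scale d ?a"
    then show "?p (x + y) \<in> range (\<lambda>c. scale c ?a)"
      by (auto intro!: image_eqI[of _ _ "c + d"] simp: lin_ext_add free.scale_left_distrib)
    show "?p (x * y) \<in> range (\<lambda>c. scale c ?a)"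
      using \<open>?p x = _\<close> \<open>?p y = _\<close>
      by (auto intro!: image_eqI[of _ _ "counit y * c + counit x * d"] simp: lin_ext_derivation[OF tree_part_add]
          lin_ext_conv_unit scale_mult_left scale_mult_right free.scale_left_distrib)
  next
    fix x c d assume "?p x = scale c ?a"
    then show "?p (scale d x) \<in> range (\<lambda>c. scale c ?a)"
      by (auto intro!: image_eqI[of _ _ "d * c"] simp: lin_ext_scale)
  qed
  moreover have "dse_coeff Bplus P m \<in> ?S" for m
    by (auto simp: tree_part_dse_coeff[OF P0] intro: image_eqI[of _ _ 0] image_eqI[of _ _ 1])
  ultimately have "unital_subalgebra hull {dse_coeff Bplus P n |n. 1 \<le> n} \<subseteq> ?S"
    by (intro hull_minimal) auto
  then show ?thesis using assms(2) by auto
qed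

lemma remove_leaf_in_subalgebra:
  assumes "hopf_subalgebra coproduct counit B" "x \<in> B"
  shows "lin_ext remove_leaf x \<in> B"
proof -
  have B: "free.subspace B" and "coproduct x \<in> free.span {tensor y z |y z. y \<in> B \<and> z \<in> B}"
    using assms by (auto simp: hopf_subalgebra_def unital_subalgebra_def)
  from this(2) have "cut_leaf (coproduct x) \<in> B"
  proof (induction rule: free.span_induct)
    show "free.subspace {t. cut_leaf t \<in> B}"
      using B unfolding free.subspace_def cut_leaf_def by (simp add: lin_ext_add lin_ext_scale)
  next
    fix t assume "t \<in> {tensor y z |y z. y \<in> B \<and> z \<in> B}"
    then obtain y z where t: "t = tensor y z" "z \<in> B" by auto
    have "cut_leaf (tensor y z) = scale (Poly_Mapping.lookup y (graft 0)) z"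
      unfolding cut_leaf_def
      by (induction y rule: basis_induct)
        (auto simp: tensor_add_left tensor_scale_left tensor_basis_vec_left lin_ext_add lin_ext_scale
          lookup_add lookup_single free.scale_left_distrib when_def lin_ext_lin_ext)
    then show "cut_leaf t \<in> B" using t B by (simp add: free.subspace_scale)
  qed
  then show ?thesis
    by (simp add: cut_leaf_def remove_leaf_def[abs_def] lin_ext_lin_ext)
qed

text \<open>A forest has as many trees as vertices iff all its trees are single vertices. This condition is
  multiplicative and gives a character, with values in the scalar multiples of \<open>1\<close>. It maps the solution
  \<open>X\<close> to \<open>h\<close>, hence \<open>P(X)\<close> to \<open>P\<close>: it reads off the coefficients of the corollas in \<open>X = B\<^sup>+(P(X))\<close>.\<close>

definition corolla_char :: "'f \<Rightarrow> ('f \<Rightarrow>\<^sub>0 'k)" where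
  "corolla_char F = (if len F = weight F then 1 else 0)"

lemma corolla_char_add: "corolla_char (F + G) = corolla_char F * corolla_char G"
  using len_le_weight[of F] len_le_weight[of G] by (auto simp: corolla_char_def len_add weight_add)

lemma corolla_char_Bplus: "lin_ext corolla_char (Bplus x) = lin_ext conv_unit x"
  by (simp add: lin_ext_lin_ext corolla_char_def conv_unit_def[abs_def] len_graft weight_graft)

subsection \<open>Necessity of the differential equation\<close>

text \<open>Let \<open>G = P(X)\<close>, so that \<open>a\<^bsub>n+1\<^esub> = B\<^sup>+(G\<^sub>n)\<close>. Deleting a leaf from \<open>a\<^bsub>n+2\<^esub>\<close> yields a
  combination of trees of weight \<open>n + 1\<close> that lies in the subalgebra, hence a multiple of \<open>a\<^bsub>n+1\<^esub>\<close>. As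
  \<open>B\<^sup>+\<close> is injective and commutes with the deletion up to the counit, the same holds for the branches.
  The factor \<open>\<mu> (Suc n)\<close> carries the weight of \<open>a\<^bsub>n+1\<^esub>\<close> as its index.\<close>

lemma remove_leaf_dse_coeff:
  assumes P0: "fps_nth P 0 = 1"
    and hopf: "hopf_subalgebra coproduct counit (unital_subalgebra hull {dse_coeff Bplus P n |n. 1 \<le> n})"
  obtains \<mu> where "\<And>n. lin_ext remove_leaf (fps_nth (fps_eval (dse P) P) (Suc n)) =
      scale (\<mu> (Suc n)) (fps_nth (fps_eval (dse P) P) n)"
proof -
  let ?G = "fps_nth (fps_eval (dse P) P)"
  have "\<exists>c. lin_ext remove_leaf (?G (Suc n)) = scale c (?G n)" for n
  proof -
    have rec: "lin_ext remove_leaf (dse_coeff Bplus P (Suc (Suc n))) = Bplus (lin_ext remove_leaf (?G (Suc n)))"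
      by (simp only: dse_coeff_Suc[OF P0] remove_leaf_Bplus conv_unit_eval_dse[OF P0] add_0_left)
    have "homogeneous (Suc n) (lin_ext remove_leaf (dse_coeff Bplus P (Suc (Suc n))))"
      using homogeneous_dse_coeff[of "Suc (Suc n)" P] weight_remove_leaf
      unfolding homogeneous_def by (fastforce dest!: subsetD[OF keys_lin_ext])
    then have "lin_ext (tree_part (\<lambda>m. m = Suc n)) (lin_ext remove_leaf (dse_coeff Bplus P (Suc (Suc n)))) =
        lin_ext remove_leaf (dse_coeff Bplus P (Suc (Suc n)))"
      unfolding rec by (simp add: tree_part_Bplus)
    note proj = this
    have "lin_ext remove_leaf (dse_coeff Bplus P (Suc (Suc n))) \<in>
        unital_subalgebra hull {dse_coeff Bplus P n |n. 1 \<le> n}"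
      by (rule remove_leaf_in_subalgebra[OF hopf], rule hull_inc) (rule CollectI, rule exI[of _ "Suc (Suc n)"], simp)
    from tree_part_dse_subalgebra[OF P0 this, of "Suc n", unfolded proj] obtain c where
        "lin_ext remove_leaf (dse_coeff Bplus P (Suc (Suc n))) = scale c (dse_coeff Bplus P (Suc n))" ..
    then have "Bplus (lin_ext remove_leaf (?G (Suc n))) = Bplus (scale c (?G n))"
      unfolding rec unfolding dse_coeff_Suc[OF P0] lin_ext_scale .
    then show ?thesis using Bplus_inject by blast
  qed
  then obtain \<mu> where "\<And>n. lin_ext remove_leaf (?G (Suc n)) = scale (\<mu> n) (?G n)"
    by metis
  then show ?thesis
    using that[of "\<lambda>n. \<mu> (n - 1)"] by simp
qed

lemma map_coeffs_remove_leaf_mult: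
  "map_coeffs (lin_ext remove_leaf) (A * B) =
   map_coeffs (lin_ext remove_leaf) A * B + A * map_coeffs (lin_ext remove_leaf) B"
proof -
  have "map_coeffs (lin_ext basis_vec) A = A" for A :: "('f \<Rightarrow>\<^sub>0 'k) fps"
    by (rule fps_ext) simp
  then show ?thesis
    using map_coeffs_derivation[of remove_leaf basis_vec A B] by (simp add: remove_leaf_add)
qed

text \<open>Let \<open>D\<close> be the deletion of a leaf, so that \<open>D(G\<^sub>n) = \<mu>\<^sub>n G\<^bsub>n-1\<^esub>\<close> for \<open>n \<ge> 1\<close>. The two recurrences are the images
  of this equation under two maps.
  The character \<open>\<psi>\<close> given by \<open>corolla_char\<close> sends \<open>X\<close> to \<open>h\<close> and \<open>D(X)\<close> to \<open>h + \<mu>\<^sub>1 h\<^sup>2\<close>, and therefore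
  \<open>D(X\<^sup>k)\<close> to \<open>k (h\<^sup>k + \<mu>\<^sub>1 h\<^bsup>k+1\<^esup>)\<close>.
  The projection \<open>\<pi>\<close> on trees annihilates \<open>D(X\<^sup>k)\<close> for \<open>k > 2\<close> and sends \<open>D(X\<^sup>2)\<close> to \<open>2 h X\<close>; the
  resulting equation is a multiple of \<open>a\<^bsub>n-1\<^esub>\<close>, which is nonzero if \<open>p\<^sub>1 \<noteq> 0\<close>: the tree
  part of \<open>G\<^sub>n\<close> is \<open>p\<^sub>1 a\<^sub>n\<close> for \<open>n \<ge> 1\<close>, so \<open>a\<^sub>n \<noteq> 0\<close> implies \<open>a\<^bsub>n+1\<^esub> = B\<^sup>+(G\<^sub>n) \<noteq> 0\<close>.\<close>

lemma dse_recurrences: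
  assumes P0: "fps_nth P 0 = 1"
    and rem: "\<And>n. lin_ext remove_leaf (fps_nth (fps_eval (dse P) P) (Suc n)) =
      scale (\<mu> (Suc n)) (fps_nth (fps_eval (dse P) P) n)"
  shows "\<mu> (Suc m) * fps_nth P m = of_nat (Suc m) * fps_nth P (Suc m) + of_nat m * \<mu> 1 * fps_nth P m"
    and "fps_nth P 1 \<noteq> 0 \<Longrightarrow>
      fps_nth P 1 * \<mu> (Suc (Suc m)) = fps_nth P 1 * \<mu> (Suc m) + 2 * fps_nth P 2"
proof -
  let ?p = "fps_nth P"
  define X where "X = dse P"
  define G where "G = fps_nth (fps_eval X P)"
  define D where "D = map_coeffs (lin_ext remove_leaf)"
  define \<psi> where "\<psi> = map_coeffs (lin_ext corolla_char)"
  define \<epsilon> where "\<epsilon> = map_coeffs (lin_ext conv_unit)"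
  define \<pi> where "\<pi> = map_coeffs (lin_ext (tree_part (\<lambda>_. True)))"
  have rem': "lin_ext remove_leaf (G (Suc n)) = scale (\<mu> (Suc n)) (G n)" for n
    using rem by (simp add: G_def X_def)
  have X_nth: "fps_nth X 0 = 0" "fps_nth X (Suc n) = Bplus (G n)" for n
    unfolding X_def G_def by (simp_all only: dse_nth[OF P0])
  have G_0: "G 0 = 1"
    by (simp add: G_def fps_eval_nth_0 P0)
  have \<epsilon>X: "\<epsilon> X = 0"
    unfolding \<epsilon>_def X_def by (rule conv_unit_dse[OF P0])
  have \<epsilon>_mult: "\<epsilon> (A * B) = \<epsilon> A * \<epsilon> B" for A B
    unfolding \<epsilon>_def by (rule map_coeffs_mult) (rule conv_unit_add)
  have \<epsilon>G: "lin_ext conv_unit (G (Suc n)) = 0" for n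
    unfolding G_def X_def by (rule conv_unit_eval_dse[OF P0])
  have conv_unit_one: "lin_ext conv_unit 1 = 1"
    by (simp add: conv_unit_def flip: single_one)
  have DX: "fps_nth (D X) (Suc 0) = 1" "fps_nth (D X) (Suc (Suc n)) = scale (\<mu> (Suc n)) (fps_nth X (Suc n))"
      "fps_nth (D X) 0 = 0" for n
    by (simp_all add: D_def X_nth remove_leaf_Bplus G_0 remove_leaf_one \<epsilon>G rem' lin_ext_scale conv_unit_one)
  have D_mult: "D (A * B) = D A * B + A * D B" for A B
    unfolding D_def by (rule map_coeffs_remove_leaf_mult)
  have D_one: "D 1 = 0"
    by (rule fps_ext) (simp add: D_def remove_leaf_one)
  have DG: "lin_ext u (lin_ext remove_leaf (G n)) = (\<Sum>k\<le>n. scale (?p k) (fps_nth (map_coeffs (lin_ext u) (D (X ^ k))) n))"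
    for u :: "'f \<Rightarrow> ('f \<Rightarrow>\<^sub>0 'k)" and n
    by (simp add: G_def fps_eval_nth_self D_def lin_ext_sum lin_ext_scale)

  \<comment> \<open>The image of \<open>D(G\<^bsub>m+1\<^esub>) = \<mu>\<^bsub>m+1\<^esub> G\<^sub>m\<close> under \<open>\<psi>\<close>: only the summands \<open>k = m\<close> and \<open>k = m + 1\<close> of
    \<open>P(X) = \<Sum>\<^sub>k p\<^sub>k X\<^sup>k\<close> contribute.\<close>
  have \<psi>_mult: "\<psi> (A * B) = \<psi> A * \<psi> B" for A B
    unfolding \<psi>_def by (rule map_coeffs_mult) (rule corolla_char_add)
  have \<psi>_add: "\<psi> (A + B) = \<psi> A + \<psi> B" for A B
    unfolding \<psi>_def by (rule map_coeffs_add)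
  have \<psi>_one: "\<psi> 1 = 1"
    unfolding \<psi>_def by (rule map_coeffs_one) (simp add: corolla_char_def)
  have \<psi>X: "\<psi> X = fps_X"
  proof (rule fps_ext)
    fix n show "fps_nth (\<psi> X) n = fps_nth fps_X n"
    proof (cases n)
      case (Suc m)
      then show ?thesis
        by (cases m) (simp_all add: \<psi>_def X_nth corolla_char_Bplus \<epsilon>G G_0 conv_unit_one)
    qed (simp add: \<psi>_def X_nth)
  qed
  have \<psi>DX: "\<psi> (D X) = fps_X + scalar_fps (\<mu> 1) * fps_X ^ 2"
  proof (rule fps_ext)
    fix n
    have *: "lin_ext corolla_char (fps_nth X (Suc m)) = fps_nth fps_X (Suc m)" for m
      using arg_cong[OF \<psi>X, of "\<lambda>f. fps_nth f (Suc m)"] by (simp add: \<psi>_def)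
    consider "n = 0" | "n = Suc 0" | m where "n = Suc (Suc m)"
      by (metis not0_implies_Suc)
    then show "fps_nth (\<psi> (D X)) n = fps_nth (fps_X + scalar_fps (\<mu> 1) * fps_X ^ 2) n"
    proof cases
      case 2
      then show ?thesis
        by (simp add: \<psi>_def DX corolla_char_def flip: single_one)
    next
      case 3
      then show ?thesis
        by (simp add: \<psi>_def DX lin_ext_scale *) (simp add: scale_eq_const_mult)
    qed (simp add: \<psi>_def DX)
  qed
  have V: "\<psi> (D (X ^ k)) = of_nat k * (fps_X ^ k + scalar_fps (\<mu> 1) * fps_X ^ Suc k)" for k
  proof (induction k)
    case 0
    show ?case by (simp add: D_one \<psi>_def fps_eq_iff)
  next
    case (Suc k)
    have "\<psi> (D (X ^ Suc k)) = \<psi> (D X) * fps_X ^ k + fps_X * \<psi> (D (X ^ k))"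
    proof -
      have "\<psi> (X ^ k) = fps_X ^ k"
        by (induction k) (simp_all add: \<psi>_one \<psi>_mult \<psi>X)
      then show ?thesis
        unfolding power_Suc D_mult \<psi>_add \<psi>_mult \<psi>X by simp
    qed
    also have "\<psi> (D X) * fps_X ^ k = fps_X ^ Suc k + scalar_fps (\<mu> 1) * fps_X ^ Suc (Suc k)"
      unfolding \<psi>DX by (simp add: distrib_right mult.assoc power2_eq_square)
    also have "fps_X * \<psi> (D (X ^ k)) = of_nat k * (fps_X ^ Suc k + scalar_fps (\<mu> 1) * fps_X ^ Suc (Suc k))"
    proof -
      have "fps_X * (of_nat k * A) = of_nat k * (fps_X * A)" for A :: "('f \<Rightarrow>\<^sub>0 'k) fps"
        by (metis mult.assoc mult_of_nat_commute)
      moreover have "fps_X * (scalar_fps (\<mu> 1) * A) = scalar_fps (\<mu> 1) * (fps_X * A)" for A :: "('f \<Rightarrow>\<^sub>0 'k) fps"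
        by (metis mult.assoc scalar_fps_commute)
      ultimately show ?thesis
        unfolding Suc by (simp only: distrib_left power_Suc)
    qed
    finally show ?case by (simp add: algebra_simps)
  qed
  have "scale (\<mu> (Suc m) * ?p m) 1 = lin_ext corolla_char (lin_ext remove_leaf (G (Suc m)))"
  proof -
    have "lin_ext corolla_char (G m) = fps_nth (fps_eval fps_X P) m"
      unfolding G_def \<psi>X[symmetric] \<psi>_def
      by (subst map_coeffs_eval[symmetric]) (simp_all add: corolla_char_add, simp add: corolla_char_def)
    also have "\<dots> = (\<Sum>k\<le>m. if k = m then scale (?p m) 1 else 0)"
      unfolding fps_eval_nth_self by (intro sum.cong) (auto simp: fps_X_power_nth)
    also have "\<dots> = scale (?p m) 1" by simp
    finally show ?thesis by (simp add: rem' lin_ext_scale)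
  qed
  also have "\<dots> = (\<Sum>k\<le>Suc m. scale (?p k) (fps_nth (of_nat k * (fps_X ^ k + scalar_fps (\<mu> 1) * fps_X ^ Suc k)) (Suc m)))"
    unfolding DG \<psi>_def[symmetric] V ..
  also have "\<dots> = (\<Sum>k\<le>Suc m. (if k = Suc m then scale (of_nat (Suc m) * ?p (Suc m)) 1 else 0) +
      (if k = m then scale (of_nat m * \<mu> 1 * ?p m) 1 else 0))"
    unfolding scalar_fps_of_nat[symmetric] scalar_fps_nth fps_add_nth
    by (intro sum.cong refl) (auto simp: fps_X_power_nth mult_ac)
  also have "\<dots> = scale (of_nat (Suc m) * ?p (Suc m) + of_nat m * \<mu> 1 * ?p m) 1"
    by (simp add: sum.distrib free.scale_left_distrib del: of_nat_Suc)
  finally show "\<mu> (Suc m) * ?p m = of_nat (Suc m) * ?p (Suc m) + of_nat m * \<mu> 1 * ?p m"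
    by simp

  \<comment> \<open>The image of \<open>D(G\<^bsub>m+2\<^esub>) = \<mu>\<^bsub>m+2\<^esub> G\<^bsub>m+1\<^esub>\<close> under \<open>\<pi>\<close>: only the summands \<open>k = 1\<close> and \<open>k = 2\<close> contribute.\<close>
  have \<pi>_mult: "\<pi> (A * B) = \<pi> A * \<epsilon> B + \<epsilon> A * \<pi> B" for A B
    unfolding \<pi>_def \<epsilon>_def by (rule map_coeffs_derivation) (rule tree_part_add)
  have \<pi>X: "\<pi> X = X"
    by (rule fps_ext) (simp add: \<pi>_def X_def tree_part_dse_coeff[OF P0])
  have \<epsilon>_power: "\<epsilon> (X ^ k) = (if k = 0 then 1 else 0)" for k
  proof (cases k)
    case 0
    then show ?thesis
      by (simp add: \<epsilon>_def map_coeffs_one conv_unit_def)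
  qed (simp add: \<epsilon>_mult \<epsilon>X)
  have \<pi>_power: "\<pi> (X ^ k) = (if k = 1 then X else 0)" for k
  proof (cases k)
    case 0
    then show ?thesis
      by (simp add: \<pi>_def map_coeffs_lin_ext_one tree_part_def)
  qed (simp add: \<pi>_mult \<epsilon>X \<pi>X \<epsilon>_power)
  have \<pi>G: "lin_ext (tree_part (\<lambda>_. True)) (G (Suc n)) = scale (?p 1) (fps_nth X (Suc n))" for n
  proof -
    have "lin_ext (tree_part (\<lambda>_. True)) (G (Suc n)) = (\<Sum>k\<le>Suc n. scale (?p k) (fps_nth (\<pi> (X ^ k)) (Suc n)))"
      by (simp add: G_def fps_eval_nth_self \<pi>_def lin_ext_sum lin_ext_scale del: sum.atMost_Suc power_Suc)
    also have "\<dots> = (\<Sum>k\<le>Suc n. if k = 1 then scale (?p 1) (fps_nth X (Suc n)) else 0)"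
      unfolding \<pi>_power by (intro sum.cong) auto
    finally show ?thesis by simp
  qed
  have \<epsilon>DX: "\<epsilon> (D X) = fps_X"
  proof (rule fps_ext)
    fix n
    have *: "lin_ext conv_unit (fps_nth X m) = 0" for m
      using arg_cong[OF \<epsilon>X, of "\<lambda>f. fps_nth f m"] by (simp add: \<epsilon>_def)
    consider "n = 0" | "n = Suc 0" | m where "n = Suc (Suc m)"
      by (metis not0_implies_Suc)
    then show "fps_nth (\<epsilon> (D X)) n = fps_nth fps_X n"
      by cases (simp_all add: \<epsilon>_def DX lin_ext_scale *, simp add: conv_unit_def flip: single_one)
  qed
  have \<epsilon>D_power: "\<epsilon> (D (X ^ k)) = (if k = 1 then fps_X else 0)" for k
  proof (cases k)
    case 0
    then show ?thesis by (simp add: D_one \<epsilon>_def fps_eq_iff)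
  next
    case (Suc j)
    have "\<epsilon> (D X * X ^ j + X * D (X ^ j)) = \<epsilon> (D X) * \<epsilon> (X ^ j) + \<epsilon> X * \<epsilon> (D (X ^ j))"
      unfolding \<epsilon>_mult[symmetric] by (simp add: \<epsilon>_def map_coeffs_add)
    then show ?thesis
      by (simp add: Suc D_mult \<epsilon>X \<epsilon>DX \<epsilon>_power)
  qed
  have \<pi>D_power: "\<pi> (D (X ^ k)) = (if k = 1 then \<pi> (D X) else if k = 2 then 2 * fps_X * X else 0)" for k
  proof (cases k)
    case 0
    then show ?thesis by (simp add: D_one \<pi>_def fps_eq_iff)
  next
    case (Suc j)
    have "\<pi> (D X * X ^ j + X * D (X ^ j)) =
        \<pi> (D X) * \<epsilon> (X ^ j) + \<epsilon> (D X) * \<pi> (X ^ j) + (\<pi> X * \<epsilon> (D (X ^ j)) + \<epsilon> X * \<pi> (D (X ^ j)))"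
      unfolding \<pi>_mult[symmetric] by (simp add: \<pi>_def map_coeffs_add)
    then show ?thesis
      by (auto simp: Suc D_mult \<epsilon>X \<epsilon>DX \<epsilon>_power \<pi>_power \<pi>X \<epsilon>D_power fps_mult_fps_X_commute mult_2 distrib_right)
  qed
  show "?p 1 * \<mu> (Suc (Suc m)) = ?p 1 * \<mu> (Suc m) + 2 * ?p 2" if p1: "?p 1 \<noteq> 0"
  proof -
    have X_neq_0: "fps_nth X (Suc n) \<noteq> 0" for n
    proof (induction n)
      case 0
      show ?case
        using Bplus_inject[of 1 0] by (auto simp: X_nth G_0)
    next
      case (Suc n)
      then have "G (Suc n) \<noteq> 0"
        using \<pi>G[of n] p1 by auto
      then show ?case
        using Bplus_inject[of "G (Suc n)" 0] by (auto simp: X_nth)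
    qed
    let ?x = "fps_nth X (Suc m)"
    have "scale (\<mu> (Suc (Suc m)) * ?p 1) ?x = lin_ext (tree_part (\<lambda>_. True)) (lin_ext remove_leaf (G (Suc (Suc m))))"
      by (simp only: rem' lin_ext_scale \<pi>G free.scale_scale)
    also have "\<dots> = (\<Sum>k\<le>Suc (Suc m). (if k = 1 then scale (?p 1) (fps_nth (\<pi> (D X)) (Suc (Suc m))) else 0) +
        (if k = 2 then scale (?p 2) (fps_nth (2 * fps_X * X) (Suc (Suc m))) else 0))"
      unfolding DG \<pi>_def[symmetric] \<pi>D_power by (intro sum.cong refl) auto
    also have "\<dots> = scale (?p 1) (fps_nth (\<pi> (D X)) (Suc (Suc m))) +
        scale (?p 2) (fps_nth (2 * fps_X * X) (Suc (Suc m)))"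
      by (simp add: sum.distrib)
    also have "fps_nth (\<pi> (D X)) (Suc (Suc m)) = scale (\<mu> (Suc m)) ?x"
      using arg_cong[OF \<pi>X, of "\<lambda>f. fps_nth f (Suc m)"] by (simp add: \<pi>_def DX lin_ext_scale)
    also have "fps_nth (2 * fps_X * X) (Suc (Suc m)) = scale 2 ?x"
      by (simp add: mult_2 distrib_right free.scale_left_distrib[of 1 1, simplified])
    finally have "scale (\<mu> (Suc (Suc m)) * ?p 1) ?x = scale (?p 1 * \<mu> (Suc m) + ?p 2 * 2) ?x"
      by (simp add: free.scale_left_distrib)
    then show ?thesis
      using X_neq_0[of m] by (simp add: mult.commute)
  qed
qed

text \<open>If \<open>p\<^sub>1 \<noteq> 0\<close>, the second recurrence makes \<open>\<mu>\<close> an arithmetic progression, and the first one becomes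
  the recurrence of the differential equation with \<open>\<alpha> = p\<^sub>1\<close> and \<open>\<alpha> \<beta> = 2 p\<^sub>2 / p\<^sub>1 - p\<^sub>1\<close>. If \<open>p\<^sub>1 = 0\<close>,
  the first one alone forces all further coefficients to vanish, one after the other.\<close>

lemma ode_if_hopf_subalgebra_dse:
  assumes P0: "fps_nth P 0 = 1"
    and hopf: "hopf_subalgebra coproduct counit (unital_subalgebra hull {dse_coeff Bplus P n |n. 1 \<le> n})"
  shows "\<exists>\<alpha> \<beta>. (1 - fps_const (\<alpha> * \<beta>) * fps_X) * fps_deriv P = fps_const \<alpha> * P"
proof -
  obtain \<mu> where "\<And>n. lin_ext remove_leaf (fps_nth (fps_eval (dse P) P) (Suc n)) =
      scale (\<mu> (Suc n)) (fps_nth (fps_eval (dse P) P) n)"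
    using remove_leaf_dse_coeff[OF P0 hopf] by blast
  note rec = dse_recurrences[OF P0 this]
  let ?p = "fps_nth P"
  have \<mu>1: "\<mu> 1 = ?p 1"
    using rec(1)[of 0] P0 by simp
  show ?thesis
  proof (cases "?p 1 = 0")
    case True
    have "?p (Suc n) = 0" for n
    proof (induction n)
      case (Suc n)
      then have "of_nat (Suc (Suc n)) * ?p (Suc (Suc n)) = 0"
        using rec(1)[of "Suc n"] by simp
      then show ?case
        by (metis mult_eq_0_iff nat.distinct(1) of_nat_eq_0_iff)
    qed (use True in simp)
    then have "(1 - fps_const (0 * 0) * fps_X) * fps_deriv P = fps_const 0 * P"
      by (simp add: fps_eq_iff)
    then show ?thesis by blast
  next
    case False
    define \<gamma> where "\<gamma> = 2 * ?p 2 / ?p 1 - ?p 1"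
    have \<mu>: "\<mu> (Suc n) = ?p 1 + of_nat n * (2 * ?p 2 / ?p 1)" for n
    proof (induction n)
      case (Suc n)
      have "\<mu> (Suc (Suc n)) = \<mu> (Suc n) + 2 * ?p 2 / ?p 1"
        using rec(2)[OF False, of n] False by (simp add: field_simps)
      then show ?case
        by (simp only: Suc of_nat_Suc distrib_right mult_1_left add_ac)
    qed (use \<mu>1 in simp)
    have "of_nat (Suc n) * ?p (Suc n) = (?p 1 + of_nat n * \<gamma>) * ?p n" for n
      using rec(1)[of n] unfolding \<mu> \<mu>1 by (simp add: \<gamma>_def algebra_simps)
    then have "(1 - fps_const \<gamma> * fps_X) * fps_deriv P = fps_const (?p 1) * P"
      unfolding ode_iff_recurrence by blast
    moreover have "\<gamma> = ?p 1 * (\<gamma> / ?p 1)"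
      using False by simp
    ultimately show ?thesis by metis
  qed
qed

lemma hopf_subalgebra_dse_iff_ode:
  assumes P0: "fps_nth P 0 = 1"
  shows "hopf_subalgebra coproduct counit (unital_subalgebra hull {dse_coeff Bplus P n |n. 1 \<le> n}) \<longleftrightarrow>
    (\<exists>\<alpha> \<beta>. (1 - fps_const (\<alpha> * \<beta>) * fps_X) * fps_deriv P = fps_const \<alpha> * P)"
  using ode_if_hopf_subalgebra_dse[OF P0] hopf_subalgebra_dse_if_ode[OF _ P0] by blast

end

section \<open>Rooted and planar rooted trees\<close>

lemma tensor_map_id_lin_ext_basis_vec:
  "tensor_map id (lin_ext (\<lambda>F. basis_vec (u F))) t = lin_ext (\<lambda>(f, g). basis_vec (f, u g)) t"
  by (simp add: tensor_map_def)

lemma tensor_basis_vec_one: "tensor (basis_vec F) 1 = basis_vec (F, 0)"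
  using tensor_basis_vec[of F 0] by simp

primrec rtree_weight :: "rtree \<Rightarrow> nat" where
  "rtree_weight (RNode F) = Suc (sum_mset (image_mset rtree_weight F))"

primrec ptree_weight :: "ptree \<Rightarrow> nat" where
  "ptree_weight (PNode F) = Suc (sum_list (map ptree_weight F))"

lemma rtree_forest_induct:
  assumes "Q 0" "\<And>G. Q G \<Longrightarrow> Q {#RNode G#}" "\<And>G H. Q G \<Longrightarrow> Q H \<Longrightarrow> Q (G + H)"
  shows "Q (F :: rtree multiset)"
proof -
  have forest: "Q F" if "\<And>t. t \<in># F \<Longrightarrow> Q {#t#}" for F
    using that
  proof (induction F)
    case (add t F)
    then have "Q ({#t#} + F)" by (intro assms(3)) auto
    then show ?case by simp
  qed (use assms(1) in simp)
  have "Q {#t#}" for t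
  proof (induction t)
    case (RNode F)
    then have "Q F" by (rule forest)
    then show ?case by (rule assms(2))
  qed
  then show ?thesis by (rule forest)
qed

lemma ptree_forest_induct:
  assumes "Q 0" "\<And>G. Q G \<Longrightarrow> Q [PNode G]" "\<And>G H. Q G \<Longrightarrow> Q H \<Longrightarrow> Q (G + H)"
  shows "Q (F :: ptree list)"
proof -
  have forest: "Q F" if "\<And>t. t \<in> set F \<Longrightarrow> Q [t]" for F
    using that
  proof (induction F)
    case (Cons t F)
    then have "Q ([t] + F)" by (intro assms(3)) auto
    then show ?case by (simp add: plus_list_def)
  qed (use assms(1) in \<open>simp add: zero_list_def\<close>)
  have "Q [t]" for t
  proof (induction t)
    case (PNode F)
    then have "Q F" by (rule forest)
    then show ?case by (rule assms(2))
  qed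
  then show ?thesis by (rule forest)
qed

global_interpretation ck: forest_bialgebra
  "\<lambda>F. {#RNode F#}" "\<lambda>F. sum_mset (image_mset rtree_weight F)" size
  "\<lambda>F. prod_mset (image_mset ck_coproduct_tree F) :: _ \<Rightarrow>\<^sub>0 'k::field_char_0"
proof
  show "Q F" if "Q 0" "\<And>G. Q G \<Longrightarrow> Q {#RNode G#}" "\<And>G H. Q G \<Longrightarrow> Q H \<Longrightarrow> Q (G + H)"
    for Q and F :: "rtree multiset"
    using that by (rule rtree_forest_induct)
qed (simp_all add: ck_graft_def tensor_map_id_lin_ext_basis_vec tensor_basis_vec_one)

global_interpretation nck: forest_bialgebra
  "\<lambda>F. [PNode F]" "\<lambda>F. sum_list (map ptree_weight F)" length
  "\<lambda>F. prod_list (map nck_coproduct_tree F) :: _ \<Rightarrow>\<^sub>0 'k::field_char_0"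
proof
  show "Q F" if "Q 0" "\<And>G. Q G \<Longrightarrow> Q [PNode G]" "\<And>G H. Q G \<Longrightarrow> Q H \<Longrightarrow> Q (G + H)"
    for Q and F :: "ptree list"
    using that by (rule ptree_forest_induct)
qed (simp_all add: nck_graft_def tensor_map_id_lin_ext_basis_vec tensor_basis_vec_one zero_list_def plus_list_def)

section \<open>Closed forms of the series\<close>

lemma recurrence_unique:
  fixes P Q :: "'k::field_char_0 fps"
  assumes "fps_nth P 0 = fps_nth Q 0"
    and "\<And>n. of_nat (Suc n) * fps_nth P (Suc n) = c n * fps_nth P n"
    and "\<And>n. of_nat (Suc n) * fps_nth Q (Suc n) = c n * fps_nth Q n"
  shows "P = Q"
proof (rule fps_ext)
  fix n show "fps_nth P n = fps_nth Q n"
  proof (induction n)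
    case (Suc n)
    then have "of_nat (Suc n) * fps_nth P (Suc n) = of_nat (Suc n) * fps_nth Q (Suc n)"
      by (simp only: assms)
    then show ?case by (simp del: of_nat_Suc)
  qed (rule assms)
qed

lemma fps_exp_recurrence:
  "of_nat (Suc n) * fps_nth (fps_exp \<alpha>) (Suc n) = \<alpha> * fps_nth (fps_exp (\<alpha>::'k::field_char_0)) n"
proof -
  have "(of_nat (Suc n) :: 'k) \<noteq> 0"
    by (simp del: of_nat_Suc)
  moreover have "(fact (Suc n) :: 'k) = of_nat (Suc n) * fact n"
    by (rule fact_Suc)
  ultimately show ?thesis
    unfolding fps_exp_nth power_Suc by (simp only: of_nat_fact times_divide_eq_right mult_divide_mult_cancel_left_if simp_thms if_False)
qed

text \<open>The quotient of consecutive coefficients of \<open>(1 - \<alpha> \<beta> h)\<close> to the power \<open>-1/\<beta>\<close> is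
  \<open>\<alpha> \<beta> (1/\<beta> + n) / (n + 1)\<close>.\<close>

lemma neg_binomial_recurrence:
  fixes \<alpha> \<beta> :: "'k::field_char_0"
  assumes "\<beta> \<noteq> 0"
  defines "Q \<equiv> neg_binomial_series (1 / \<beta>) oo (fps_const (\<alpha> * \<beta>) * fps_X)"
  shows "fps_nth Q 0 = 1"
    and "of_nat (Suc n) * fps_nth Q (Suc n) = (\<alpha> + of_nat n * (\<alpha> * \<beta>)) * fps_nth Q n"
proof -
  have Q: "fps_nth Q n = (\<alpha> * \<beta>) ^ n * (pochhammer (1 / \<beta>) n / fact n)" for n
    by (simp add: Q_def neg_binomial_series_def fps_compose_linear)
  show "fps_nth Q 0 = 1" by (simp add: Q)
  have "of_nat (Suc n) * fps_nth Q (Suc n) = (\<alpha> * \<beta>) * (1 / \<beta> + of_nat n) * fps_nth Q n"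
    by (simp add: Q pochhammer_Suc fact_Suc mult_ac del: of_nat_Suc)
  then show "of_nat (Suc n) * fps_nth Q (Suc n) = (\<alpha> + of_nat n * (\<alpha> * \<beta>)) * fps_nth Q n"
    using assms(1) by (simp add: distrib_left mult_ac)
qed

lemma ode_iff_closed_form:
  fixes P :: "'k::field_char_0 fps"
  assumes P0: "fps_nth P 0 = 1"
  shows "(1 - fps_const (\<alpha> * \<beta>) * fps_X) * fps_deriv P = fps_const \<alpha> * P \<longleftrightarrow>
    (\<alpha> = 0 \<longrightarrow> P = 1) \<and> (\<beta> = 0 \<longrightarrow> P = fps_exp \<alpha>) \<and>
    (\<alpha> * \<beta> \<noteq> 0 \<longrightarrow> P = neg_binomial_series (1 / \<beta>) oo (fps_const (\<alpha> * \<beta>) * fps_X))"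
  (is "?ode \<longleftrightarrow> ?closed")
proof -
  let ?c = "\<lambda>n. \<alpha> + of_nat n * (\<alpha> * \<beta>)"
  have rec: "?ode \<longleftrightarrow> (\<forall>n. of_nat (Suc n) * fps_nth P (Suc n) = ?c n * fps_nth P n)"
    by (rule ode_iff_recurrence)
  have unique: "?ode \<longleftrightarrow> P = Q"
    if "fps_nth Q 0 = 1" "\<And>n. of_nat (Suc n) * fps_nth Q (Suc n) = ?c n * fps_nth Q n" for Q
    unfolding rec using that P0 recurrence_unique[of P Q ?c] by auto
  consider "\<alpha> = 0" | "\<alpha> \<noteq> 0" "\<beta> = 0" | "\<alpha> * \<beta> \<noteq> 0" by auto
  then show ?thesis
  proof cases
    case 1
    then have "?ode \<longleftrightarrow> P = 1" by (intro unique) simp_all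
    then show ?thesis using 1 by auto
  next
    case 2
    then have "?ode \<longleftrightarrow> P = fps_exp \<alpha>"
      by (intro unique) (simp_all add: fps_exp_recurrence del: of_nat_Suc fps_exp_nth, simp)
    then show ?thesis using 2 by auto
  next
    case 3
    then have "?ode \<longleftrightarrow> P = neg_binomial_series (1 / \<beta>) oo (fps_const (\<alpha> * \<beta>) * fps_X)"
      by (intro unique neg_binomial_recurrence) simp_all
    then show ?thesis using 3 by auto
  qed
qed

theorem theorem4:
  fixes P :: "'k::field_char_0 fps"
  assumes "fps_nth P 0 = 1"
  shows
    "(hopf_subalgebra nck_coproduct counit (nck_dse_subalgebra P) \<longleftrightarrow>
      hopf_subalgebra ck_coproduct counit (ck_dse_subalgebra P)) \<and>
     (hopf_subalgebra ck_coproduct counit (ck_dse_subalgebra P) \<longleftrightarrow>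
      (\<exists>\<alpha> \<beta>. (1 - fps_const (\<alpha> * \<beta>) * fps_X) * fps_deriv P = fps_const \<alpha> * P \<and> fps_nth P 0 = 1)) \<and>
     ((\<exists>\<alpha> \<beta>. (1 - fps_const (\<alpha> * \<beta>) * fps_X) * fps_deriv P = fps_const \<alpha> * P \<and> fps_nth P 0 = 1) \<longleftrightarrow>
      (\<exists>\<alpha> \<beta>.
         (\<alpha> = 0 \<longrightarrow> P = 1) \<and>
         (\<beta> = 0 \<longrightarrow> P = fps_exp \<alpha>) \<and>
         (\<alpha> * \<beta> \<noteq> 0 \<longrightarrow> P = neg_binomial_series (1 / \<beta>) oo (fps_const (\<alpha> * \<beta>) * fps_X))))"
proof -
  have "hopf_subalgebra ck_coproduct counit (ck_dse_subalgebra P) \<longleftrightarrow>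
      (\<exists>\<alpha> \<beta>. (1 - fps_const (\<alpha> * \<beta>) * fps_X) * fps_deriv P = fps_const \<alpha> * P)"
    unfolding ck_coproduct_def ck_dse_subalgebra_def ck_graft_def
    by (rule ck.hopf_subalgebra_dse_iff_ode[OF assms])
  moreover have "hopf_subalgebra nck_coproduct counit (nck_dse_subalgebra P) \<longleftrightarrow>
      (\<exists>\<alpha> \<beta>. (1 - fps_const (\<alpha> * \<beta>) * fps_X) * fps_deriv P = fps_const \<alpha> * P)"
    unfolding nck_coproduct_def nck_dse_subalgebra_def nck_graft_def
    by (rule nck.hopf_subalgebra_dse_iff_ode[OF assms])
  ultimately show ?thesis
    by (simp only: ode_iff_closed_form[OF assms] assms simp_thms)
qed

end
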